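(* There is an algorithm that, given a graph $G$ on $n$ vertices, computes the pathwidth of $G$ in time $O^*(2^{k'})$, where $k'$ is the size of a minimum vertex cover of the complement graph $\overline{G}$.
   Context: All graphs are finite, simple and undirected. The complement $\overline{G}$ of $G=(V,E)$ has vertex set $V$ and edges exactly the pairs of distinct vertices non-adjacent in $G$. A vertex cover of a graph is a vertex set containing at least one endpoint of every edge. A path decomposition of $G$ is a sequence of bags $X_1,\dots,X_p\subseteq V$ such that every vertex lies in some bag, every edge has both endpoints in some bag, and for each vertex the indices of bags containing it form an interval; its width is $\max_i|X_i|-1$ and the pathwidth of $G$ is the minimum width of a path decomposition. The notation $f(n,k)=O^*(g(n,k))$ means $f(n,k)=O(g(n,k)\cdot n^{O(1)})$. *)

theory Defs
  imports Complex_Main "HOL-Library.Landau_Symbols" "HOL-Library.Log_Nat"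
begin

section \<open>Graphs\<close>

definition simple_graph :: "'a set \<Rightarrow> 'a set set \<Rightarrow> bool" where
  "simple_graph V E \<longleftrightarrow> finite V \<and> (\<forall>e\<in>E. e \<subseteq> V \<and> card e = 2)"

definition complement_edges :: "'a set \<Rightarrow> 'a set set \<Rightarrow> 'a set set" where
  "complement_edges V E = {{u, v} | u v. u \<in> V \<and> v \<in> V \<and> u \<noteq> v \<and> {u, v} \<notin> E}"

definition vertex_cover :: "'a set \<Rightarrow> 'a set set \<Rightarrow> 'a set \<Rightarrow> bool" where
  "vertex_cover V E C \<longleftrightarrow> C \<subseteq> V \<and> (\<forall>e\<in>E. C \<inter> e \<noteq> {})"

definition vertex_cover_number :: "'a set \<Rightarrow> 'a set set \<Rightarrow> nat" where
  "vertex_cover_number V E = (LEAST k. \<exists>C. vertex_cover V E C \<and> card C = k)"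

definition path_decomposition :: "'a set \<Rightarrow> 'a set set \<Rightarrow> 'a set list \<Rightarrow> bool" where
  "path_decomposition V E Xs \<longleftrightarrow>
     Xs \<noteq> [] \<and>
     (\<forall>X \<in> set Xs. X \<subseteq> V) \<and>
     (\<forall>v\<in>V. \<exists>X \<in> set Xs. v \<in> X) \<and>
     (\<forall>e\<in>E. \<exists>X \<in> set Xs. e \<subseteq> X) \<and>
     (\<forall>v\<in>V. \<forall>i j k. i \<le> j \<and> j \<le> k \<and> k < length Xs \<and> v \<in> Xs ! i \<and> v \<in> Xs ! k \<longrightarrow> v \<in> Xs ! j)"

text \<open>Widths are integers, so that the graph without vertices has pathwidth \<open>-1\<close>.\<close>

definition width :: "'a set list \<Rightarrow> int" where
  "width Xs = Max ((\<lambda>X. int (card X)) ` set Xs) - 1"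

definition pathwidth :: "'a set \<Rightarrow> 'a set set \<Rightarrow> int" where
  "pathwidth V E = (LEAST w. \<exists>Xs. path_decomposition V E Xs \<and> width Xs = w)"


section \<open>Machine model\<close>

text \<open>
  Algorithms are programs of a structured random access machine with the logarithmic cost
  criterion. The memory consists of integer cells with integer addresses; \<open>Cell a\<close> reads the cell
  whose address is the value of \<open>a\<close>, so that indirect addressing is available. Unlike unit cost,
  logarithmic cost charges each computed number (addresses included) by its binary length, so no
  work can be hidden in arithmetic on huge numbers.
\<close>

datatype binop = Plus | Minus | Times | Div

datatype expr = Const int | Cell expr | Op binop expr expr

datatype prog =
    Skip
  | Assign expr expr      \<comment> \<open>\<open>Assign a e\<close> writes the value of \<open>e\<close> to the cell with address \<open>a\<close>\<close>
  | Seq prog prog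
  | If_pos expr prog prog
  | While_pos expr prog

type_synonym memory = "int \<Rightarrow> int"

fun apply_op :: "binop \<Rightarrow> int \<Rightarrow> int \<Rightarrow> int" where
  "apply_op Plus x y = x + y"
| "apply_op Minus x y = x - y"
| "apply_op Times x y = x * y"
| "apply_op Div x y = x div y"

fun val :: "expr \<Rightarrow> memory \<Rightarrow> int" where
  "val (Const c) m = c"
| "val (Cell a) m = m (val a m)"
| "val (Op f a b) m = apply_op f (val a m) (val b m)"

definition log_size :: "int \<Rightarrow> nat" where
  "log_size x = 1 + nat (bitlen \<bar>x\<bar>)"

fun expr_cost :: "expr \<Rightarrow> memory \<Rightarrow> nat" where
  "expr_cost (Const c) m = log_size c"
| "expr_cost (Cell a) m = expr_cost a m + log_size (val (Cell a) m)"
| "expr_cost (Op f a b) m = expr_cost a m + expr_cost b m + log_size (val (Op f a b) m)"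

text \<open>\<open>exec P m t m'\<close>: started in memory \<open>m\<close>, the program \<open>P\<close> halts after time \<open>t\<close> in memory \<open>m'\<close>.\<close>

inductive exec :: "prog \<Rightarrow> memory \<Rightarrow> nat \<Rightarrow> memory \<Rightarrow> bool" where
  exec_Skip: "exec Skip m 1 m"
| exec_Assign:
    "exec (Assign a e) m (1 + expr_cost a m + expr_cost e m) (m(val a m := val e m))"
| exec_Seq:
    "exec P m t m' \<Longrightarrow> exec Q m' t' m'' \<Longrightarrow> exec (Seq P Q) m (t + t') m''"
| exec_If_true:
    "val b m > 0 \<Longrightarrow> exec P m t m' \<Longrightarrow> exec (If_pos b P Q) m (1 + expr_cost b m + t) m'"
| exec_If_false:
    "\<not> val b m > 0 \<Longrightarrow> exec Q m t m' \<Longrightarrow> exec (If_pos b P Q) m (1 + expr_cost b m + t) m'"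
| exec_While_true:
    "val b m > 0 \<Longrightarrow> exec P m t m' \<Longrightarrow> exec (While_pos b P) m' t' m'' \<Longrightarrow>
     exec (While_pos b P) m (1 + expr_cost b m + t + t') m''"
| exec_While_false:
    "\<not> val b m > 0 \<Longrightarrow> exec (While_pos b P) m (1 + expr_cost b m) m"

inductive_cases exec_SkipE: "exec Skip m t m'"
inductive_cases exec_AssignE: "exec (Assign a e) m t m'"
inductive_cases exec_SeqE: "exec (Seq P Q) m t m'"
inductive_cases exec_IfE: "exec (If_pos b P Q) m t m'"
inductive_cases exec_WhileE: "exec (While_pos b P) m t m'"

lemma exec_deterministic:
  "exec P m t m' \<Longrightarrow> exec P m u m'' \<Longrightarrow> t = u \<and> m' = m''"
proof (induction arbitrary: u m'' rule: exec.induct)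
  case (exec_Skip m)
  then show ?case by (auto elim: exec_SkipE)
next
  case (exec_Assign a e m)
  then show ?case by (auto elim: exec_AssignE)
next
  case (exec_Seq P m t m1 Q t' m2)
  obtain v w k where "u = v + w" "exec P m v k" "exec Q k w m''"
    using exec_Seq.prems by (rule exec_SeqE)
  then show ?case using exec_Seq.IH(1)[of v k] exec_Seq.IH(2)[of w m''] by simp
next
  case (exec_If_true b m P t m1 Q)
  obtain v where "u = 1 + expr_cost b m + v" "exec P m v m''"
    using exec_If_true.prems exec_If_true.hyps by (auto elim: exec_IfE)
  then show ?case using exec_If_true.IH[of v m''] by simp
next
  case (exec_If_false b m Q t m1 P)
  obtain v where "u = 1 + expr_cost b m + v" "exec Q m v m''"
    using exec_If_false.prems exec_If_false.hyps by (auto elim: exec_IfE)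
  then show ?case using exec_If_false.IH[of v m''] by simp
next
  case (exec_While_true b m P t m1 t' m2)
  obtain v w k where "u = 1 + expr_cost b m + v + w" "exec P m v k" "exec (While_pos b P) k w m''"
    using exec_While_true.prems exec_While_true.hyps by (auto elim: exec_WhileE)
  then show ?case using exec_While_true.IH(1)[of v k] exec_While_true.IH(2)[of w m''] by simp
next
  case (exec_While_false b m P)
  then show ?case by (auto elim: exec_WhileE)
qed

text \<open>
  A graph with vertex set \<open>{..<n}\<close> is given by \<open>n\<close> in cell \<open>0\<close> and the adjacency matrix, row by
  row, in the cells \<open>1, \<dots>, n\<^sup>2\<close>; all other cells are \<open>0\<close>.
\<close>

definition graph_input :: "nat \<Rightarrow> nat set set \<Rightarrow> memory" where
  "graph_input n E = (\<lambda>a.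
     if a = 0 then int n
     else if \<exists>u<n. \<exists>v<n. a = 1 + int u * int n + int v \<and> {u, v} \<in> E then 1
     else 0)"


section \<open>Running times\<close>

text \<open>
  \<open>f(n,k) = O(g(n,k) \<cdot> n\<^bsup>O(1)\<^esup>)\<close>. The filter makes the estimate hold for all sufficiently large \<open>n\<close>,
  with constants that are uniform in \<open>k\<close>.
\<close>

definition O_star :: "(nat \<Rightarrow> nat \<Rightarrow> real) \<Rightarrow> (nat \<Rightarrow> nat \<Rightarrow> real) set" where
  "O_star g = {f. \<exists>d::nat. (\<lambda>(n, k). f n k)
     \<in> O[sequentially \<times>\<^sub>F top](\<lambda>(n, k). g n k * real n ^ d)}"

end

theory Submission
  imports Defs
begin

text \<open>
  Let \<open>C\<close> be a vertex cover of the complement, so that \<open>V - C\<close> is a clique. By the Helly property, every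
  path decomposition has a bag containing \<open>V - C\<close>. Let \<open>L\<close> and \<open>R\<close> be the sets of vertices which
  occur only before, respectively only after, this bag. Both are non-adjacent subsets of \<open>C\<close>, and
  the bag is \<open>V - (L \<union> R)\<close>. The part before the bag amounts to an elimination order of \<open>L\<close>; when \<open>v\<close>
  is eliminated after \<open>S\<close>, the bag is \<open>N[S \<union> {v}] - S\<close>, whose size \<open>|N[M]| - |M| + 1\<close> depends only
  on \<open>M = S \<union> {v}\<close>. The part after the bag is symmetric.

  Hence bags of size at most \<open>w\<close> suffice iff there are sweepable \<open>L\<close> and \<open>R \<subseteq> C - N[L]\<close> with
  \<open>n \<le> w + |L| + |R|\<close>. To avoid the \<open>3\<^sup>k\<close> pairs \<open>(L, R)\<close>, one computes for every \<open>M \<subseteq> C\<close>, by dynamic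
  programming over the \<open>2\<^sup>k\<close> subsets, the largest size \<open>best M\<close> of a sweepable subset of \<open>M\<close>, and then
  looks for \<open>L\<close> with \<open>best L = |L|\<close> and \<open>n \<le> w + |L| + best (C - N[L])\<close>.

  The cover is found by bounded branching: the bits of a number \<open>j\<close> decide which endpoint of each
  uncovered complement edge is taken, halving \<open>j\<close> each time. The first \<open>j\<close> that is not exhausted is below
  \<open>2\<^bsup>k + 1\<^esup>\<close> and at least \<open>2\<^sup>c\<close>, where \<open>c\<close> is the size of its cover, whence \<open>c \<le> k\<close>.
\<close>

section \<open>Pathwidth in terms of sweepable sets\<close>

definition nbhd :: "'a set set \<Rightarrow> 'a set \<Rightarrow> 'a set" where
  "nbhd E S = S \<union> {u. \<exists>v\<in>S. {u, v} \<in> E}"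

inductive sweepable :: "'a set set \<Rightarrow> nat \<Rightarrow> 'a set \<Rightarrow> bool" for E w where
  empty: "sweepable E w {}"
| insert: "sweepable E w S \<Longrightarrow> v \<notin> S \<Longrightarrow> card (nbhd E (insert v S) - S) \<le> w \<Longrightarrow>
    sweepable E w (insert v S)"

text \<open>The last inequality bounds the size of the central bag \<open>V - (L \<union> R)\<close>
  by \<open>w\<close>, written without subtraction.\<close>

definition feasible :: "'a set \<Rightarrow> 'a set set \<Rightarrow> 'a set \<Rightarrow> nat \<Rightarrow> bool" where
  "feasible V E C w \<longleftrightarrow> (\<exists>L R. L \<subseteq> C \<and> R \<subseteq> C \<and> sweepable E w L \<and> sweepable E w R \<and>
     R \<inter> nbhd E L = {} \<and> card V \<le> w + card L + card R)"

section \<open>The interval condition for sequences of bags\<close>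

definition interval_list :: "'a set list \<Rightarrow> bool" where
  "interval_list Xs \<longleftrightarrow>
     (\<forall>v i j k. i \<le> j \<and> j \<le> k \<and> k < length Xs \<and> v \<in> Xs ! i \<and> v \<in> Xs ! k \<longrightarrow> v \<in> Xs ! j)"

text \<open>An element occurring on both sides of \<open>Z\<close> lies in \<open>Z\<close>. A
  triple of indices straddling \<open>Z\<close> can therefore be cut at the position of
  \<open>Z\<close>, and the middle index falls into one of the two halves.\<close>

lemma interval_list_glue:
  assumes "interval_list (Xs @ [Z])" "interval_list (Z # Ys)"
    and sep: "\<And>a. a \<in> \<Union>(set Xs) \<Longrightarrow> a \<in> \<Union>(set Ys) \<Longrightarrow> a \<in> Z"
  shows "interval_list (Xs @ Z # Ys)"
  unfolding interval_list_def
proof (intro allI impI, elim conjE)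
  fix v i j k
  let ?Z = "Xs @ Z # Ys" and ?l = "length Xs"
  assume ij: "i \<le> j" "j \<le> k" and k: "k < length ?Z" and vi: "v \<in> ?Z ! i" and vk: "v \<in> ?Z ! k"
  have left: "v \<in> ?Z ! b" if "a \<le> b" "b \<le> c" "c \<le> ?l" "v \<in> ?Z ! a" "v \<in> ?Z ! c" for a b c
  proof -
    have eq: "?Z ! x = (Xs @ [Z]) ! x" if "x \<le> ?l" for x
      using that by (auto simp: nth_append)
    show ?thesis
      using assms(1)[unfolded interval_list_def, rule_format, of a b c v] that eq[of a] eq[of b] eq[of c]
      by auto
  qed
  have right: "v \<in> ?Z ! b"
    if "?l \<le> a" "a \<le> b" "b \<le> c" "c < length ?Z" "v \<in> ?Z ! a" "v \<in> ?Z ! c" for a b c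
  proof -
    have eq: "?Z ! x = (Z # Ys) ! (x - ?l)" if "?l \<le> x" for x
      using that by (auto simp: nth_append)
    have "a - ?l \<le> b - ?l" "b - ?l \<le> c - ?l" "c - ?l < length (Z # Ys)" using that by auto
    then have "v \<in> (Z # Ys) ! (b - ?l)"
      using assms(2)[unfolded interval_list_def, rule_format, of "a - ?l" "b - ?l" "c - ?l" v] that eq[of a] eq[of c]
      by auto
    then show ?thesis using eq[of b] that by auto
  qed
  consider "k \<le> ?l" | "?l \<le> i" | "i < ?l" "?l < k" by linarith
  then show "v \<in> ?Z ! j"
  proof cases
    case 1
    then show ?thesis using left[of i j k] ij vi vk by auto
  next
    case 2
    then show ?thesis using right[of i j k] ij vi vk k by auto
  next
    case 3
    have "v \<in> \<Union>(set Xs)" using 3 vi by (auto simp: nth_append)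
    moreover have "v \<in> Ys ! (k - ?l - 1)" using 3 vk by (auto simp: nth_append)
    moreover have "Ys ! (k - ?l - 1) \<in> set Ys" using 3 k by (intro nth_mem) auto
    ultimately have "v \<in> Z" using sep by blast
    then have "v \<in> ?Z ! ?l" by simp
    then show ?thesis
      using left[of i j ?l] right[of ?l j k] 3 ij vi vk k by (cases "j \<le> ?l") auto
  qed
qed

lemma interval_list_rev: "interval_list Xs \<Longrightarrow> interval_list (rev Xs)"
  unfolding interval_list_def
proof (intro allI impI, elim conjE)
  fix v i j k
  assume H: "\<forall>v i j k. i \<le> j \<and> j \<le> k \<and> k < length Xs \<and> v \<in> Xs ! i \<and> v \<in> Xs ! k \<longrightarrow> v \<in> Xs ! j"
    and *: "i \<le> j" "j \<le> k" "k < length (rev Xs)" "v \<in> rev Xs ! i" "v \<in> rev Xs ! k"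
  show "v \<in> rev Xs ! j"
    using H[rule_format, of "length Xs - Suc k" "length Xs - Suc j" "length Xs - Suc i" v] *
    by (simp add: rev_nth diff_le_mono2)
qed

lemma interval_list_pair: "interval_list [X, Y]"
  unfolding interval_list_def by (auto simp: less_Suc_eq le_Suc_eq)

text \<open>Bags are subsets of \<open>V\<close>, so quantifying over the vertices already covers
  every element of a bag.\<close>

lemma path_decomposition_interval_list:
  assumes "path_decomposition V E Xs"
  shows "interval_list Xs"
  unfolding interval_list_def
proof (intro allI impI, elim conjE)
  fix v i j k
  assume *: "i \<le> j" "j \<le> k" "k < length Xs" "v \<in> Xs ! i" "v \<in> Xs ! k"
  then have "v \<in> V" using assms unfolding path_decomposition_def by (meson nth_mem subsetD)
  then show "v \<in> Xs ! j" using assms * unfolding path_decomposition_def by blast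
qed

lemma path_decomposition_iff:
  "path_decomposition V E Xs \<longleftrightarrow> Xs \<noteq> [] \<and> (\<forall>X \<in> set Xs. X \<subseteq> V) \<and> (\<forall>v\<in>V. \<exists>X \<in> set Xs. v \<in> X) \<and>
     (\<forall>e\<in>E. \<exists>X \<in> set Xs. e \<subseteq> X) \<and> interval_list Xs" (is "_ \<longleftrightarrow> ?rhs")
proof
  assume P: "path_decomposition V E Xs"
  show ?rhs
    using P path_decomposition_interval_list[OF P] unfolding path_decomposition_def
    by (elim conjE) (intro conjI; assumption)
next
  assume R: ?rhs
  then have "interval_list Xs" by (elim conjE)
  then have "\<forall>v\<in>V. \<forall>i j k. i \<le> j \<and> j \<le> k \<and> k < length Xs \<and> v \<in> Xs ! i \<and> v \<in> Xs ! k \<longrightarrow> v \<in> Xs ! j"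
    unfolding interval_list_def by (intro ballI) (erule spec)
  with R show "path_decomposition V E Xs"
    unfolding path_decomposition_def by (elim conjE) (intro conjI; assumption)
qed

lemma path_decomposition_rev: "path_decomposition V E Xs \<Longrightarrow> path_decomposition V E (rev Xs)"
  by (simp add: path_decomposition_iff interval_list_rev)

lemma width_le_iff: "Xs \<noteq> [] \<Longrightarrow> width Xs \<le> int w - 1 \<longleftrightarrow> (\<forall>X\<in>set Xs. card X \<le> w)"
  unfolding width_def by (subst diff_le_eq) (simp del: Max_less_iff)

lemma simple_graph_edge: "simple_graph V E \<Longrightarrow> {u, v} \<in> E \<Longrightarrow> u \<in> V \<and> v \<in> V \<and> u \<noteq> v"
  unfolding simple_graph_def by (cases "u = v") auto

lemma simple_graph_edgeE:
  assumes "simple_graph V E" "e \<in> E"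
  obtains u v where "e = {u, v}" "u \<in> V" "v \<in> V" "u \<noteq> v"
  using assms unfolding simple_graph_def by (metis card_2_iff insert_subset)

section \<open>From sweepable sets to path decompositions\<close>

lemma nbhd_mono: "S \<subseteq> T \<Longrightarrow> nbhd E S \<subseteq> nbhd E T"
  unfolding nbhd_def by auto

lemma nbhd_disjoint_sym:
  assumes "R \<inter> nbhd E L = {}"
  shows "L \<inter> nbhd E R = {}"
proof -
  have False if "x \<in> L" "v \<in> R" "{x, v} \<in> E" for x v
  proof -
    have "{v, x} \<in> E" using that(3) by (metis insert_commute)
    then show False using assms that by (auto simp: nbhd_def)
  qed
  moreover have "L \<inter> R = {}" using assms by (auto simp: nbhd_def)
  ultimately show ?thesis by (auto simp: nbhd_def)
qed

lemma nbhd_subset: "simple_graph V E \<Longrightarrow> S \<subseteq> V \<Longrightarrow> nbhd E S \<subseteq> V"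
  unfolding nbhd_def using simple_graph_edge by fastforce

text \<open>The last bag \<open>Z\<close> is arbitrary: it stands for whatever follows the sweep.\<close>

definition sweep_bags :: "'a set set \<Rightarrow> nat \<Rightarrow> 'a set \<Rightarrow> 'a set list \<Rightarrow> bool" where
  "sweep_bags E w L Xs \<longleftrightarrow>
    (\<forall>X\<in>set Xs. X \<subseteq> nbhd E L \<and> card X \<le> w) \<and> L \<subseteq> \<Union>(set Xs) \<and>
    (\<forall>e\<in>E. e \<inter> L \<noteq> {} \<longrightarrow> (\<exists>X\<in>set Xs. e \<subseteq> X)) \<and>
    (\<forall>Z. Z \<inter> L = {} \<longrightarrow> nbhd E L - L \<subseteq> Z \<longrightarrow> interval_list (Xs @ [Z]))"

lemma sweep_bagsD:
  assumes "sweep_bags E w L Xs"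
  shows "X \<in> set Xs \<Longrightarrow> X \<subseteq> nbhd E L" "X \<in> set Xs \<Longrightarrow> card X \<le> w" "L \<subseteq> \<Union>(set Xs)"
    "e \<in> E \<Longrightarrow> e \<inter> L \<noteq> {} \<Longrightarrow> \<exists>X\<in>set Xs. e \<subseteq> X"
    "Z \<inter> L = {} \<Longrightarrow> nbhd E L - L \<subseteq> Z \<Longrightarrow> interval_list (Xs @ [Z])"
  using assms by (simp_all add: sweep_bags_def)

text \<open>Each elimination step appends the bag \<open>N[S \<union> {v}] - S\<close>. This bag
  separates the earlier bags from whatever follows.\<close>

lemma sweepable_bags:
  assumes "sweepable E w L" "simple_graph V E"
  shows "\<exists>Xs. sweep_bags E w L Xs"
  using assms(1)
proof induction
  case empty
  show ?case by (intro exI[of _ "[]"]) (auto simp: sweep_bags_def interval_list_def)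
next
  case (insert S v)
  then obtain Xs where "sweep_bags E w S Xs" by auto
  note Xs = sweep_bagsD[OF this]
  define B where "B = nbhd E (insert v S) - S"
  have mono: "nbhd E S \<subseteq> nbhd E (insert v S)" by (intro nbhd_mono) auto
  have vB: "v \<in> B" using insert by (auto simp: B_def nbhd_def)
  have "sweep_bags E w (insert v S) (Xs @ [B])"
    unfolding sweep_bags_def
  proof (intro conjI ballI allI impI)
    fix X assume "X \<in> set (Xs @ [B])"
    then show "X \<subseteq> nbhd E (insert v S)" "card X \<le> w"
      using Xs(1,2)[of X] mono insert by (auto simp: B_def)
  next
    show "insert v S \<subseteq> \<Union>(set (Xs @ [B]))" using Xs(3) vB by auto
  next
    fix e assume e: "e \<in> E" "e \<inter> insert v S \<noteq> {}"
    show "\<exists>X\<in>set (Xs @ [B]). e \<subseteq> X"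
    proof (cases "e \<inter> S = {}")
      case True
      obtain a b where "e = {a, b}" using simple_graph_edgeE[OF assms(2) e(1)] by metis
      moreover have "v \<in> e" using e(2) True by auto
      ultimately obtain u where "e = {u, v}" by auto
      then have "e \<subseteq> B" using True e(1) by (auto simp: B_def nbhd_def)
      then show ?thesis by simp
    next
      case False
      then show ?thesis using Xs(4)[OF e(1)] by auto
    qed
  next
    fix Z assume Z: "Z \<inter> insert v S = {}" "nbhd E (insert v S) - insert v S \<subseteq> Z"
    \<comment> \<open>The new bag serves as \<open>Z\<close> in the induction hypothesis: it avoids
      \<open>S\<close> and contains \<open>N[S] - S\<close>.\<close>
    have "interval_list (Xs @ [B])" using mono by (intro Xs(5)) (auto simp: B_def)
    moreover have "interval_list [B, Z]" by (rule interval_list_pair)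
    \<comment> \<open>Such a vertex lies in \<open>N[S]\<close> and, being in \<open>Z\<close>,
      outside \<open>S\<close>.\<close>
    moreover have "a \<in> B" if "a \<in> \<Union>(set Xs)" "a \<in> \<Union>(set [Z])" for a
      using that Z Xs(1) mono by (auto simp: B_def)
    ultimately show "interval_list ((Xs @ [B]) @ [Z])"
      using interval_list_glue[of Xs B "[Z]"] by simp
  qed
  then show ?case by blast
qed

text \<open>The sweep of \<open>L\<close>, the central bag \<open>X\<close> and the reversed sweep
  of \<open>R\<close> are concatenated. A vertex seen by both sweeps lies in \<open>N[L]\<close> and
  in \<open>N[R]\<close>, hence in neither \<open>L\<close> nor \<open>R\<close>, and so in
  \<open>X\<close>. An edge meeting neither \<open>L\<close> nor \<open>R\<close> lies in
  \<open>X\<close>.\<close>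

lemma path_decomposition_of_feasible:
  assumes G: "simple_graph V E" and "C \<subseteq> V" and "feasible V E C w"
  shows "\<exists>Xs. path_decomposition V E Xs \<and> width Xs \<le> int w - 1"
proof -
  obtain L R where LR: "L \<subseteq> V" "R \<subseteq> V" "sweepable E w L" "sweepable E w R" "R \<inter> nbhd E L = {}"
    and card: "card V \<le> w + card L + card R"
    using assms(2,3) unfolding feasible_def by (elim exE conjE) (rule that; auto)
  have sym: "L \<inter> nbhd E R = {}" by (rule nbhd_disjoint_sym[OF LR(5)])
  have disj: "L \<inter> R = {}" using LR(5) by (auto simp: nbhd_def)
  define X where "X = V - (L \<union> R)"
  obtain Xs where "sweep_bags E w L Xs" using sweepable_bags[OF LR(3) G] by auto
  note Xs = sweep_bagsD[OF this]
  obtain Ys where "sweep_bags E w R Ys" using sweepable_bags[OF LR(4) G] by auto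
  note Ys = sweep_bagsD[OF this]
  have sub: "nbhd E L \<subseteq> V" "nbhd E R \<subseteq> V" using LR G nbhd_subset by blast+
  have fin: "finite V" using G by (simp add: simple_graph_def)
  have cX: "card X \<le> w"
  proof -
    have "card (L \<union> R) = card L + card R"
      using disj LR fin by (intro card_Un_disjoint) (auto intro: finite_subset)
    moreover have "card X = card V - card (L \<union> R)"
      unfolding X_def using LR fin by (intro card_Diff_subset) (auto intro: finite_subset)
    ultimately show ?thesis using card by linarith
  qed
  have iX: "interval_list (Xs @ [X])" using LR sub by (intro Xs(5)) (auto simp: X_def)
  have "interval_list (Ys @ [X])" using sym sub by (intro Ys(5)) (auto simp: X_def)
  from interval_list_rev[OF this] have iY: "interval_list (X # rev Ys)" by simp
  have iv: "interval_list (Xs @ X # rev Ys)"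
  proof (rule interval_list_glue[OF iX iY])
    fix a assume "a \<in> \<Union>(set Xs)" "a \<in> \<Union>(set (rev Ys))"
    then have "a \<in> nbhd E L" "a \<in> nbhd E R" using Xs(1) Ys(1) by auto
    then show "a \<in> X" using LR(5) sym sub by (auto simp: X_def)
  qed
  let ?Zs = "Xs @ X # rev Ys"
  have "path_decomposition V E ?Zs"
    unfolding path_decomposition_iff
  proof (intro conjI ballI iv)
    fix B assume "B \<in> set ?Zs"
    then consider "B \<in> set Xs" | "B = X" | "B \<in> set Ys" by auto
    then show "B \<subseteq> V"
    proof cases
      case 1
      from Xs(1)[OF this] show ?thesis using sub(1) by (rule subset_trans)
    next
      case 2
      then show ?thesis by (simp add: X_def)
    next
      case 3
      from Ys(1)[OF this] show ?thesis using sub(2) by (rule subset_trans)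
    qed
  next
    fix v assume "v \<in> V"
    then have "v \<in> \<Union>(set ?Zs)" using Xs(3) Ys(3) by (auto simp: X_def)
    then show "\<exists>B\<in>set ?Zs. v \<in> B" by blast
  next
    fix e assume e: "e \<in> E"
    show "\<exists>B\<in>set ?Zs. e \<subseteq> B"
    proof (cases "e \<inter> L = {} \<and> e \<inter> R = {}")
      case True
      then have "e \<subseteq> X" using e G by (auto simp: X_def simple_graph_def)
      then show ?thesis by auto
    next
      case False
      then show ?thesis using Xs(4)[OF e] Ys(4)[OF e] by auto
    qed
  qed simp
  moreover have "width ?Zs \<le> int w - 1"
  proof (subst width_le_iff)
    show "\<forall>B\<in>set ?Zs. card B \<le> w" using Xs(2) Ys(2) cX by (simp add: ball_Un)
  qed simp
  ultimately show ?thesis by blast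
qed

section \<open>From path decompositions to sweepable sets\<close>

definition last_bag :: "'a set list \<Rightarrow> 'a \<Rightarrow> nat" where
  "last_bag Xs v = Max {i. i < length Xs \<and> v \<in> Xs ! i}"

lemma last_bag:
  assumes "i < length Xs" "v \<in> Xs ! i"
  shows "last_bag Xs v < length Xs" "v \<in> Xs ! last_bag Xs v" "i \<le> last_bag Xs v"
proof -
  let ?A = "{i. i < length Xs \<and> v \<in> Xs ! i}"
  have "finite ?A" "i \<in> ?A" using assms by auto
  then show "last_bag Xs v < length Xs" "v \<in> Xs ! last_bag Xs v" "i \<le> last_bag Xs v"
    unfolding last_bag_def using Max_in[of ?A] Max_ge[of ?A i] by blast+
qed

lemma last_bag_less_length:
  assumes "path_decomposition V E Xs" "v \<in> V"
  shows "last_bag Xs v < length Xs" "v \<in> Xs ! last_bag Xs v"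
proof -
  obtain i where "i < length Xs" "v \<in> Xs ! i"
    using assms unfolding path_decomposition_def by (metis in_set_conv_nth)
  from last_bag[OF this] show "last_bag Xs v < length Xs" "v \<in> Xs ! last_bag Xs v" by simp_all
qed

text \<open>The vertices are swept in the order in which they leave the bags.\<close>

lemma sweepable_of_path_decomposition:
  assumes P: "path_decomposition V E Xs" and G: "simple_graph V E"
    and wd: "\<And>X. X \<in> set Xs \<Longrightarrow> card X \<le> w"
    and S: "S \<subseteq> V" "\<And>u v. v \<in> S \<Longrightarrow> u \<in> V \<Longrightarrow> last_bag Xs u < last_bag Xs v \<Longrightarrow> u \<in> S"
  shows "sweepable E w S"
proof -
  have fin: "finite V" using G by (simp add: simple_graph_def)
  have iv: "interval_list Xs" using P by (simp add: path_decomposition_iff)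
  have "finite S" using S(1) fin finite_subset by blast
  then show ?thesis using S
  proof (induction S rule: finite_psubset_induct)
    case (psubset S)
    show ?case
    proof (cases "S = {}")
      case True
      then show ?thesis by (simp add: sweepable.empty)
    next
      case False
      then have "Max (last_bag Xs ` S) \<in> last_bag Xs ` S" using psubset.hyps by simp
      \<comment> \<open>The vertex \<open>v\<close> leaves last among \<open>S\<close>, so
        \<open>S - {v}\<close> is still closed under leaving earlier.\<close>
      then obtain v where v: "v \<in> S" "last_bag Xs v = Max (last_bag Xs ` S)" by auto
      have vmax: "last_bag Xs u \<le> last_bag Xs v" if "u \<in> S" for u
        unfolding v(2) using that psubset.hyps by simp
      let ?i = "last_bag Xs v"
      have il: "?i < length Xs" using last_bag_less_length[OF P] v(1) psubset.prems(1) by auto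
      have "sweepable E w (S - {v})"
      proof (rule psubset.IH)
        fix u x assume "x \<in> S - {v}" "u \<in> V" "last_bag Xs u < last_bag Xs x"
        then show "u \<in> S - {v}" using psubset.prems(2)[of x u] vmax[of x] by auto
      qed (use v psubset.prems in auto)
      \<comment> \<open>The elimination bag of \<open>v\<close> fits into the last bag containing
        \<open>v\<close>: each of its vertices occurs in that bag or an earlier one, since a
        neighbour in \<open>S\<close> has left by then, and it does not leave before
        \<open>v\<close>.\<close>
      moreover have "nbhd E S - (S - {v}) \<subseteq> Xs ! ?i"
      proof
        fix u assume u: "u \<in> nbhd E S - (S - {v})"
        have uV: "u \<in> V" using nbhd_subset[OF G psubset.prems(1)] u by auto
        have late: "?i \<le> last_bag Xs u"
        proof (cases "u = v")
          case False
          then have "u \<notin> S" using u by auto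
          then show ?thesis using psubset.prems(2)[OF v(1) uV] by force
        qed simp
        obtain i where i: "i \<le> ?i" "u \<in> Xs ! i"
        proof (cases "u \<in> S")
          case True
          then have "u = v" using u by auto
          then show ?thesis using that[of ?i] last_bag_less_length[OF P uV] by auto
        next
          case False
          then obtain x where x: "x \<in> S" "{u, x} \<in> E" using u by (auto simp: nbhd_def)
          obtain X where "X \<in> set Xs" "{u, x} \<subseteq> X" using P x(2) unfolding path_decomposition_iff by blast
          then obtain i where i: "i < length Xs" "u \<in> Xs ! i" "x \<in> Xs ! i" by (auto simp: in_set_conv_nth)
          then show ?thesis using that[of i] last_bag(3)[of i Xs x] vmax[OF x(1)] by auto
        qed
        show "u \<in> Xs ! ?i"
          using iv[unfolded interval_list_def, rule_format, of i ?i "last_bag Xs u" u] i late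
            last_bag_less_length[OF P uV] by auto
      qed
      moreover have "card (Xs ! ?i) \<le> w" using wd nth_mem[OF il] by blast
      moreover have "finite (Xs ! ?i)"
        using P fin nth_mem[OF il] unfolding path_decomposition_iff by (metis finite_subset)
      ultimately have "sweepable E w (insert v (S - {v}))"
        using v(1) card_mono[of "Xs ! ?i" "nbhd E S - (S - {v})"]
        by (intro sweepable.insert) (auto simp: insert_absorb)
      then show ?thesis using v(1) by (simp add: insert_absorb)
    qed
  qed
qed

text \<open>Helly property for intervals. Let \<open>v\<close> be the clique vertex that leaves
  first. Every other clique vertex shares a bag with \<open>v\<close> and does not leave before it,
  so it is present in the last bag of \<open>v\<close>.\<close>

lemma clique_bag:
  assumes P: "path_decomposition V E Xs" and K: "K \<subseteq> V" "finite K"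
    and clique: "\<And>u v. u \<in> K \<Longrightarrow> v \<in> K \<Longrightarrow> u \<noteq> v \<Longrightarrow> {u, v} \<in> E"
  shows "\<exists>j<length Xs. K \<subseteq> Xs ! j"
proof (cases "K = {}")
  case True
  then show ?thesis using P by (auto simp: path_decomposition_iff)
next
  case False
  then have "Min (last_bag Xs ` K) \<in> last_bag Xs ` K" using K by simp
  then obtain v where v: "v \<in> K" "last_bag Xs v = Min (last_bag Xs ` K)" by auto
  have vmin: "last_bag Xs v \<le> last_bag Xs u" if "u \<in> K" for u
    unfolding v(2) using that K by simp
  let ?i = "last_bag Xs v"
  have iv: "interval_list Xs" using P by (simp add: path_decomposition_iff)
  have "u \<in> Xs ! ?i" if u: "u \<in> K" for u
  proof (cases "u = v")
    case True
    then show ?thesis using last_bag_less_length(2)[OF P, of u] u K by auto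
  next
    case False
    obtain X where "X \<in> set Xs" "{u, v} \<subseteq> X"
      using P clique[OF u v(1) False] unfolding path_decomposition_iff by blast
    then obtain i where i: "i < length Xs" "u \<in> Xs ! i" "v \<in> Xs ! i" by (auto simp: in_set_conv_nth)
    show ?thesis
      using iv[unfolded interval_list_def, rule_format, of i ?i "last_bag Xs u" u] vmin[OF u] i
        last_bag[OF i(1,2)] last_bag[OF i(1,3)] by auto
  qed
  moreover have "?i < length Xs" using last_bag_less_length(1)[OF P, of v] v(1) K by auto
  ultimately show ?thesis by auto
qed

lemma sweepable_before_bag:
  assumes P: "path_decomposition V E Xs" and G: "simple_graph V E"
    and wd: "\<And>X. X \<in> set Xs \<Longrightarrow> card X \<le> w"
  shows "sweepable E w {v \<in> V. last_bag Xs v < j}"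
  using assms by (intro sweepable_of_path_decomposition[OF P G wd]) auto

text \<open>Bag \<open>j\<close> contains the clique \<open>V - C\<close>. The sets \<open>L\<close>
  and \<open>R\<close> consist of the vertices that occur only before it and only after it. They
  miss bag \<open>j\<close>, hence lie in \<open>C\<close>; no bag meets both of them, so they are
  non-adjacent. All other vertices are in bag \<open>j\<close>, which gives the count.\<close>

lemma feasible_of_path_decomposition:
  assumes G: "simple_graph V E" and C: "C \<subseteq> V"
    and clique: "\<And>u v. u \<in> V - C \<Longrightarrow> v \<in> V - C \<Longrightarrow> u \<noteq> v \<Longrightarrow> {u, v} \<in> E"
    and P: "path_decomposition V E Xs" and "width Xs \<le> int w - 1"
  shows "feasible V E C w"
proof -
  have fin: "finite V" using G by (simp add: simple_graph_def)
  have wd: "\<And>X. X \<in> set Xs \<Longrightarrow> card X \<le> w"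
    using assms(5) P width_le_iff[of Xs w] unfolding path_decomposition_iff by blast
  obtain j where j: "j < length Xs" "V - C \<subseteq> Xs ! j"
    using clique_bag[OF P, of "V - C"] clique fin by auto
  let ?l = "length Xs"
  have iv: "interval_list Xs" using P by (simp add: path_decomposition_iff)
  have ex: "\<exists>i<?l. u \<in> Xs ! i" if "u \<in> V" for u
    using P that unfolding path_decomposition_def by (metis in_set_conv_nth)
  define L where "L = {v \<in> V. last_bag Xs v < j}"
  \<comment> \<open>Position \<open>?l - Suc j\<close> of the reversed list is bag \<open>j\<close>
    of \<open>Xs\<close>.\<close>
  define R where "R = {v \<in> V. last_bag (rev Xs) v < ?l - Suc j}"
  have Lc: "i < j" if "v \<in> L" "i < ?l" "v \<in> Xs ! i" for i v
    using that last_bag(3)[of i Xs v] by (auto simp: L_def)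
  have Rc: "j < i" if "v \<in> R" "i < ?l" "v \<in> Xs ! i" for i v
  proof -
    have "?l - Suc i < length (rev Xs)" "v \<in> rev Xs ! (?l - Suc i)" using that by (auto simp: rev_nth)
    then have "?l - Suc i \<le> last_bag (rev Xs) v" by (rule last_bag(3))
    moreover have "last_bag (rev Xs) v < ?l - Suc j" using that by (simp add: R_def)
    ultimately show ?thesis by linarith
  qed
  have rest: "v \<in> Xs ! j" if vV: "v \<in> V" and "v \<notin> L" "v \<notin> R" for v
  proof -
    obtain i where i: "i < ?l" "v \<in> Xs ! i" using ex[OF vV] by auto
    have a: "last_bag Xs v < ?l" "v \<in> Xs ! last_bag Xs v" "j \<le> last_bag Xs v"
      using last_bag[OF i] that by (auto simp: L_def)
    have i': "?l - Suc i < length (rev Xs)" "v \<in> rev Xs ! (?l - Suc i)"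
      using i by (auto simp: rev_nth)
    let ?r = "last_bag (rev Xs) v"
    have b: "?r < ?l" "v \<in> Xs ! (?l - Suc ?r)" "?l - Suc ?r \<le> j"
      using last_bag[OF i'] that by (auto simp: R_def rev_nth)
    show ?thesis
      using iv[unfolded interval_list_def, rule_format, of "?l - Suc ?r" j "last_bag Xs v" v] a b by auto
  qed
  have notj: "v \<notin> Xs ! j" if "v \<in> L \<union> R" for v
    using that Lc[of v j] Rc[of v j] j by auto
  have LR: "L \<subseteq> C" "R \<subseteq> C" using notj j(2) by (auto simp: L_def R_def)
  have disj: "x \<notin> R" if x: "x \<in> L" for x
  proof -
    obtain i where "i < ?l" "x \<in> Xs ! i" using ex[of x] x by (auto simp: L_def)
    from Lc[OF x this] Rc[OF _ this] show ?thesis by auto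
  qed
  have sep: "R \<inter> nbhd E L = {}"
  proof -
    have False if x: "x \<in> L" "y \<in> R" "{y, x} \<in> E" for x y
    proof -
      obtain X where "X \<in> set Xs" "{y, x} \<subseteq> X" using P x(3) unfolding path_decomposition_iff by blast
      then obtain i where "i < ?l" "x \<in> Xs ! i" "y \<in> Xs ! i" by (auto simp: in_set_conv_nth)
      then show False using Lc[OF x(1), of i] Rc[OF x(2), of i] by simp
    qed
    then show ?thesis using disj by (auto simp: nbhd_def)
  qed
  have "card V \<le> card (Xs ! j) + (card L + card R)"
  proof -
    have "card V \<le> card (Xs ! j \<union> (L \<union> R))"
    proof (rule card_mono)
      have "Xs ! j \<subseteq> V" using P nth_mem[OF j(1)] by (simp add: path_decomposition_iff)
      then show "finite (Xs ! j \<union> (L \<union> R))"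
        using fin by (auto simp: L_def R_def intro: finite_subset)
      show "V \<subseteq> Xs ! j \<union> (L \<union> R)" using rest by blast
    qed
    also have "\<dots> \<le> card (Xs ! j) + (card L + card R)"
      using card_Un_le[of "Xs ! j" "L \<union> R"] card_Un_le[of L R] by linarith
    finally show ?thesis .
  qed
  moreover have "card (Xs ! j) \<le> w" using wd j by simp
  moreover have "sweepable E w L" unfolding L_def by (rule sweepable_before_bag[OF P G wd])
  moreover have "sweepable E w R" unfolding R_def
    by (rule sweepable_before_bag[OF path_decomposition_rev[OF P] G]) (use wd in auto)
  ultimately show ?thesis using LR sep unfolding feasible_def by (intro exI[of _ L] exI[of _ R]) auto
qed

section \<open>Pathwidth as the least feasible bag size\<close>

lemma feasible_card: "feasible V E C (card V)"
  unfolding feasible_def by (intro exI[of _ "{}"]) (auto simp: sweepable.empty nbhd_def)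

lemma pathwidth_eq_Least_feasible:
  assumes G: "simple_graph V E" and C: "C \<subseteq> V"
    and clique: "\<And>u v. u \<in> V - C \<Longrightarrow> v \<in> V - C \<Longrightarrow> u \<noteq> v \<Longrightarrow> {u, v} \<in> E"
  shows "pathwidth V E = int (LEAST w. feasible V E C w) - 1"
proof -
  let ?w = "LEAST w. feasible V E C w"
  have f: "feasible V E C ?w" using feasible_card by (rule LeastI)
  have low: "int ?w - 1 \<le> width Xs" if P: "path_decomposition V E Xs" for Xs
  proof -
    have "Xs \<noteq> []" using P by (simp add: path_decomposition_iff)
    \<comment> \<open>Bag sizes are non-negative, so every width, the value -1 included, has the
      form \<open>int w - 1\<close> with a natural number \<open>w\<close>.\<close>
    then have "0 \<le> Max ((\<lambda>X. int (card X)) ` set Xs)"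
      by (subst Max_ge_iff) (auto simp: neq_Nil_conv)
    then have nn: "width Xs = int (nat (width Xs + 1)) - 1" by (simp add: width_def)
    then have "feasible V E C (nat (width Xs + 1))"
      by (intro feasible_of_path_decomposition[OF G C clique P]) auto
    then have "?w \<le> nat (width Xs + 1)" by (rule Least_le)
    then show ?thesis using nn by linarith
  qed
  obtain Xs where Xs: "path_decomposition V E Xs" "width Xs \<le> int ?w - 1"
    using path_decomposition_of_feasible[OF G C f] by blast
  \<comment> \<open>The integers are not well-founded, so the minimum is exhibited by a
    decomposition attaining the lower bound.\<close>
  show ?thesis unfolding pathwidth_def
    using Xs low by (intro Least_equality) force+
qed

section \<open>The dynamic programming recurrence\<close>

definition best :: "'a set set \<Rightarrow> nat \<Rightarrow> 'a set \<Rightarrow> nat" where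
  "best E w M = Max (card ` {S. S \<subseteq> M \<and> sweepable E w S})"

lemma best_ge: "finite M \<Longrightarrow> S \<subseteq> M \<Longrightarrow> sweepable E w S \<Longrightarrow> card S \<le> best E w M"
  unfolding best_def by (intro Max_ge) auto

lemma best_obtains:
  assumes "finite M"
  obtains S where "S \<subseteq> M" "sweepable E w S" "card S = best E w M"
proof -
  have "best E w M \<in> card ` {S. S \<subseteq> M \<and> sweepable E w S}"
    unfolding best_def using assms sweepable.empty[of E w] by (intro Max_in) auto
  then show ?thesis using that by auto
qed

lemma best_le_card: "finite M \<Longrightarrow> best E w M \<le> card M"
  by (metis best_obtains card_mono)

text \<open>The table of the numbers \<open>best\<close> thereby also records which sets are
  sweepable.\<close>

lemma best_eq_card_iff: "finite M \<Longrightarrow> best E w M = card M \<longleftrightarrow> sweepable E w M"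
  by (metis best_ge best_le_card best_obtains card_subset_eq le_antisym order_refl)

lemma best_mono: "finite M \<Longrightarrow> S \<subseteq> M \<Longrightarrow> best E w S \<le> best E w M"
  by (metis best_ge best_obtains finite_subset order_trans)

lemma sweepable_remove_iff:
  "M \<noteq> {} \<Longrightarrow> sweepable E w M \<longleftrightarrow>
    (\<exists>v\<in>M. sweepable E w (M - {v}) \<and> card (nbhd E M - (M - {v})) \<le> w)"
proof
  assume "M \<noteq> {}" "sweepable E w M"
  then show "\<exists>v\<in>M. sweepable E w (M - {v}) \<and> card (nbhd E M - (M - {v})) \<le> w"
    by (auto elim: sweepable.cases)
next
  assume "\<exists>v\<in>M. sweepable E w (M - {v}) \<and> card (nbhd E M - (M - {v})) \<le> w"
  then show "sweepable E w M" using sweepable.insert[of E w "M - {_}"] by (metis Diff_iff insert_Diff insertI1)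
qed

text \<open>The set \<open>A\<close> is the part of \<open>M\<close> scanned so far, which lets the
  maximum be accumulated one vertex at a time; 0 is its starting value.\<close>

definition best_remove :: "'a set set \<Rightarrow> nat \<Rightarrow> 'a set \<Rightarrow> 'a set \<Rightarrow> nat" where
  "best_remove E w M A = Max (insert 0 ((\<lambda>v. best E w (M - {v})) ` A))"

lemma best_remove_empty [simp]: "best_remove E w M {} = 0"
  by (simp add: best_remove_def)

lemma best_remove_insert:
  "finite A \<Longrightarrow> best_remove E w M (insert v A) = max (best E w (M - {v})) (best_remove E w M A)"
  unfolding best_remove_def
  by (simp add: insert_commute[of 0])

lemma best_remove_le: "finite M \<Longrightarrow> A \<subseteq> M \<Longrightarrow> best_remove E w M A \<le> card M"
proof -
  assume *: "finite M" "A \<subseteq> M"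
  have "best E w (M - {v}) \<le> card M" for v
    using best_le_card[of "M - {v}" E w] card_mono[of M "M - {v}"] * by fastforce
  then show ?thesis using finite_subset[OF *(2,1)] by (auto simp: best_remove_def)
qed

text \<open>A sweepable subset of \<open>M\<close> is \<open>M\<close> itself or misses some
  \<open>v\<close>. The set \<open>M\<close> is sweepable iff some \<open>M - {v}\<close> is, that
  is, if the best value after a removal reaches \<open>card M - 1\<close>, and
  \<open>|N[M]| - |M| + 1 \<le> w\<close>. The second condition does not depend on \<open>v\<close>,
  so the two can be tested separately.\<close>

lemma best_rec:
  assumes M: "finite M" "finite (nbhd E M)"
  shows "best E w M = (if card M \<le> best_remove E w M M + 1 \<and> card (nbhd E M) < w + card M
    then card M else best_remove E w M M)"
proof (cases "M = {}")
  case True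
  then show ?thesis using best_le_card[of M E w] by simp
next
  case False
  have sub: "M \<subseteq> nbhd E M" by (auto simp: nbhd_def)
  let ?b = "best_remove E w M M"
  have bge: "best E w (M - {v}) \<le> ?b" if "v \<in> M" for v
    unfolding best_remove_def using M that by (intro Max_ge) auto
  have bin: "\<exists>v\<in>M. ?b = best E w (M - {v})"
  proof -
    have "?b \<in> insert 0 ((\<lambda>v. best E w (M - {v})) ` M)"
      unfolding best_remove_def using M by (intro Max_in) auto
    moreover obtain v where "v \<in> M" using False by auto
    ultimately show ?thesis using bge[of v] by fastforce
  qed
  have cN: "card (nbhd E M - (M - {v})) = card (nbhd E M) - card M + 1" if "v \<in> M" for v
  proof -
    have "card (nbhd E M - (M - {v})) = card (nbhd E M) - card (M - {v})"
      using M sub by (intro card_Diff_subset) auto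
    moreover have "card (M - {v}) = card M - 1" "0 < card M" "card M \<le> card (nbhd E M)"
      using that M sub by (auto simp: card_gt_0_iff intro: card_mono)
    ultimately show ?thesis by linarith
  qed
  have cM: "card (M - {v}) + 1 = card M" if "v \<in> M" for v
    using that M by (metis card_Suc_Diff1 Suc_eq_plus1)
  have le: "card M \<le> card (nbhd E M)" using M sub by (intro card_mono)
  have sw: "sweepable E w M \<longleftrightarrow> card M \<le> ?b + 1 \<and> card (nbhd E M) < w + card M"
  proof
    assume "sweepable E w M"
    then obtain v where v: "v \<in> M" "sweepable E w (M - {v})" "card (nbhd E M - (M - {v})) \<le> w"
      using sweepable_remove_iff[OF False] by blast
    have "best E w (M - {v}) = card (M - {v})" using v(2) M by (simp add: best_eq_card_iff)
    then show "card M \<le> ?b + 1 \<and> card (nbhd E M) < w + card M"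
      using bge[OF v(1)] cM[OF v(1)] cN[OF v(1)] v(3) le by linarith
  next
    assume *: "card M \<le> ?b + 1 \<and> card (nbhd E M) < w + card M"
    obtain v where v: "v \<in> M" "?b = best E w (M - {v})" using bin by blast
    have "best E w (M - {v}) = card (M - {v})"
      using * v cM[OF v(1)] best_le_card[of "M - {v}" E w] M by auto
    then have "sweepable E w (M - {v})" using M by (simp add: best_eq_card_iff)
    then show "sweepable E w M"
      using sweepable_remove_iff[OF False] v(1) cN[OF v(1)] * le by auto
  qed
  have "best E w M = ?b" if "\<not> sweepable E w M"
  proof (rule antisym)
    obtain S where S: "S \<subseteq> M" "sweepable E w S" "card S = best E w M" using best_obtains[OF M(1)] .
    then have "S \<noteq> M" using that by auto
    then obtain v where v: "v \<in> M" "S \<subseteq> M - {v}" using S(1) by blast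
    show "best E w M \<le> ?b" using best_ge[OF _ v(2) S(2)] S(3) bge[OF v(1)] M by simp
    show "?b \<le> best E w M" using bin best_mono[OF M(1), of "M - {_}" E w] by auto
  qed
  then show ?thesis using sw best_eq_card_iff[OF M(1), of E w] by auto
qed

text \<open>Once \<open>L\<close> is fixed, \<open>R\<close> may be taken as a largest sweepable
  subset of \<open>C - N[L]\<close>, so only \<open>L\<close> has to be enumerated.\<close>

lemma feasible_iff_best:
  assumes "finite C"
  shows "feasible V E C w \<longleftrightarrow>
    (\<exists>L\<subseteq>C. best E w L = card L \<and> card V \<le> w + card L + best E w (C - nbhd E L))"
proof
  assume "feasible V E C w"
  then obtain L R where LR: "L \<subseteq> C" "R \<subseteq> C" "sweepable E w L" "sweepable E w R"
     "R \<inter> nbhd E L = {}" "card V \<le> w + card L + card R" unfolding feasible_def by blast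
  have "card R \<le> best E w (C - nbhd E L)" using LR assms by (intro best_ge) auto
  moreover have "best E w L = card L"
    using LR assms finite_subset best_eq_card_iff by blast
  ultimately show "\<exists>L\<subseteq>C. best E w L = card L \<and> card V \<le> w + card L + best E w (C - nbhd E L)"
    using LR by (intro exI[of _ L]) auto
next
  assume "\<exists>L\<subseteq>C. best E w L = card L \<and> card V \<le> w + card L + best E w (C - nbhd E L)"
  then obtain L where L: "L \<subseteq> C" "best E w L = card L" "card V \<le> w + card L + best E w (C - nbhd E L)"
    by blast
  have "sweepable E w L" using L(1,2) assms finite_subset best_eq_card_iff by blast
  moreover obtain R where "R \<subseteq> C - nbhd E L" "sweepable E w R" "card R = best E w (C - nbhd E L)"
    using best_obtains[of "C - nbhd E L"] assms by blast
  ultimately show "feasible V E C w" unfolding feasible_def using L by (intro exI[of _ L] exI[of _ R]) auto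
qed

section \<open>Guided branching for the cover\<close>

text \<open>The matrix index \<open>e\<close> stands for the pair \<open>(e div n, e mod n)\<close>.
  The first component holds the unread bits of the guide, and a bit is consumed only at a complement
  edge that is still uncovered.\<close>

fun branch :: "nat \<Rightarrow> nat set set \<Rightarrow> nat \<Rightarrow> nat \<times> nat set \<Rightarrow> nat \<times> nat set" where
  "branch n E e (x, S) =
    (if e div n < e mod n \<and> {e div n, e mod n} \<notin> E \<and> e div n \<notin> S \<and> e mod n \<notin> S
     then (x div 2, insert (if odd x then e div n else e mod n) S) else (x, S))"

definition guided :: "nat \<Rightarrow> nat set set \<Rightarrow> nat \<Rightarrow> nat \<Rightarrow> nat \<times> nat set" where
  "guided n E j e = fold (branch n E) [0..<e] (j, {})"

lemma guided_0 [simp]: "guided n E j 0 = (j, {})"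
  by (simp add: guided_def)

lemma guided_Suc [simp]: "guided n E j (Suc e) = branch n E e (guided n E j e)"
  by (simp add: guided_def)

definition guided_cover :: "nat \<Rightarrow> nat set set \<Rightarrow> nat \<Rightarrow> nat set" where
  "guided_cover n E j = snd (guided n E j (n * n))"

text \<open>A positive rest means that the guide outlasted the scan; this is what bounds the size of
  the cover by the length of the guide.\<close>

definition guided_rest :: "nat \<Rightarrow> nat set set \<Rightarrow> nat \<Rightarrow> nat" where
  "guided_rest n E j = fst (guided n E j (n * n))"

lemma guided_subset: "e \<le> n * n \<Longrightarrow> snd (guided n E j e) \<subseteq> {..<n}"
proof (induction e)
  case (Suc e)
  obtain x S where eq: "guided n E j e = (x, S)" by fastforce
  have "e div n < n" "e mod n < n" using Suc.prems
    by (auto simp: less_mult_imp_div_less) (metis gr0I less_nat_zero_code mod_less_divisor mult_is_0 Suc_le_lessD)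
  then show ?case using Suc eq by auto
qed simp

lemma guided_mono: "e \<le> e' \<Longrightarrow> snd (guided n E j e) \<subseteq> snd (guided n E j e')"
proof (induction e' rule: dec_induct)
  case (step e')
  then show ?case by (cases "guided n E j e'") auto
qed simp

text \<open>Every branching halves the guide and inserts exactly one new vertex, as both endpoints
  were outside the set.\<close>

lemma fst_guided:
  "e \<le> n * n \<Longrightarrow> fst (guided n E j e) = j div 2 ^ card (snd (guided n E j e))"
proof (induction e)
  case (Suc e)
  obtain x S where eq: "guided n E j e = (x, S)" by fastforce
  have "finite S" using guided_subset[of e n E j] Suc.prems eq finite_subset by auto
  then show ?case using Suc eq by (auto simp: div_mult2_eq[symmetric] mult.commute)
qed simp

text \<open>The pair is covered once its index \<open>e\<close> has been scanned, and vertices are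
  never removed. This holds for every guide: once exhausted, it only supplies zero bits.\<close>

lemma guided_cover:
  assumes "u < v" "v < n" "{u, v} \<notin> E"
  shows "u \<in> guided_cover n E j \<or> v \<in> guided_cover n E j"
proof -
  define e where "e = u * n + v"
  have e: "e div n = u" "e mod n = v" using assms by (auto simp: e_def)
  have "u * n + v < Suc u * n" using assms by simp
  also have "\<dots> \<le> n * n" using assms by (intro mult_le_mono1) auto
  finally have "Suc e \<le> n * n" by (simp add: e_def)
  then have "snd (guided n E j (Suc e)) \<subseteq> guided_cover n E j"
    unfolding guided_cover_def by (rule guided_mono)
  moreover have "u \<in> snd (guided n E j (Suc e)) \<or> v \<in> snd (guided n E j (Suc e))"
    using e assms by (cases "guided n E j e") auto
  ultimately show ?thesis by blast
qed

text \<open>The bits of the guide are determined backwards from the last branching.\<close>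

lemma guide_exists:
  assumes C: "finite C" "\<And>u v. u < v \<Longrightarrow> v < n \<Longrightarrow> {u, v} \<notin> E \<Longrightarrow> u \<in> C \<or> v \<in> C"
    and n: "\<And>e. e \<in> set es \<Longrightarrow> e mod n < n" and "S \<subseteq> C"
  shows "\<exists>x. x < 2 ^ (card C - card S + 1) \<and> 0 < fst (fold (branch n E) es (x, S))"
  using n \<open>S \<subseteq> C\<close>
proof (induction es arbitrary: S)
  case Nil
  have "(1::nat) < 2 ^ (card C - card S + 1)" by (rule one_less_power) auto
  \<comment> \<open>The guide 1 is a leading bit that survives the scan; it accounts for the extra
    factor 2 in the bound.\<close>
  then show ?case by (intro exI[of _ 1]) auto
next
  case (Cons e es)
  let ?u = "e div n" and ?v = "e mod n"
  have v: "?v < n" using Cons.prems by simp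
  show ?case
  proof (cases "?u < ?v \<and> {?u, ?v} \<notin> E \<and> ?u \<notin> S \<and> ?v \<notin> S")
    case False
    obtain x where x: "x < 2 ^ (card C - card S + 1)" "0 < fst (fold (branch n E) es (x, S))"
      using Cons.IH[OF _ Cons.prems(2)] Cons.prems(1) by auto
    have "fold (branch n E) (e # es) (x, S) = fold (branch n E) es (x, S)" using False by auto
    then show ?thesis using x by metis
  next
    case True
    define y where "y = (if ?u \<in> C then ?u else ?v)"
    have y: "y \<in> C" "y \<notin> S" using True C(2) v by (auto simp: y_def)
    have fS: "finite S" using Cons.prems(2) C(1) finite_subset by blast
    have "card (insert y S) \<le> card C" using y Cons.prems(2) C(1) by (intro card_mono) auto
    then have card: "card C - card S = Suc (card C - card (insert y S))" using y fS by simp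
    obtain x where x: "x < 2 ^ (card C - card (insert y S) + 1)"
      "0 < fst (fold (branch n E) es (x, insert y S))"
      using Cons.IH[of "insert y S"] Cons.prems y by auto
    \<comment> \<open>The bit put in front of \<open>x\<close> selects the endpoint \<open>y\<close>
      belonging to \<open>C\<close>.\<close>
    define z where "z = 2 * x + (if ?u \<in> C then 1 else 0)"
    have "z < 2 ^ (card C - card S + 1)" using x(1) card by (auto simp: z_def)
    moreover have "fold (branch n E) (e # es) (z, S) = fold (branch n E) es (x, insert y S)"
      using True by (simp add: z_def y_def)
    ultimately show ?thesis using x(2) by metis
  qed
qed

text \<open>A minimum cover of the complement steers the branching: every chosen vertex can be taken
  from it.\<close>

lemma guide_exists_vertex_cover_number:
  "\<exists>j. j < 2 ^ (vertex_cover_number {..<n} (complement_edges {..<n} E) + 1) \<and> 0 < guided_rest n E j"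
proof -
  let ?E = "complement_edges {..<n} E"
  have "\<exists>k C. vertex_cover {..<n} ?E C \<and> card C = k"
    by (intro exI[of _ "card {..<n}"] exI[of _ "{..<n}"])
      (auto simp: vertex_cover_def complement_edges_def)
  then have "\<exists>C. vertex_cover {..<n} ?E C \<and> card C = vertex_cover_number {..<n} ?E"
    unfolding vertex_cover_number_def by (rule LeastI_ex)
  then obtain C where C: "vertex_cover {..<n} ?E C" "card C = vertex_cover_number {..<n} ?E" by blast
  have "u \<in> C \<or> v \<in> C" if "u < v" "v < n" "{u, v} \<notin> E" for u v
  proof -
    have "{u, v} \<in> ?E"
      unfolding complement_edges_def using that by (intro CollectI exI[of _ u] exI[of _ v]) auto
    then show ?thesis using C(1) by (auto simp: vertex_cover_def)
  qed
  moreover have "finite C" using C(1) finite_subset by (auto simp: vertex_cover_def)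
  moreover have "e mod n < n" if "e \<in> set [0..<n * n]" for e
    using that by (cases n) auto
  ultimately show ?thesis
    using guide_exists[of C n E "[0..<n * n]" "{}"] C(2) by (auto simp: guided_rest_def guided_def)
qed

lemma vertex_cover_number_le: "vertex_cover_number {..<n} (complement_edges {..<n} E) \<le> n"
  unfolding vertex_cover_number_def
  by (rule order_trans[OF Least_le[of _ "card {..<n}"]])
    (auto intro!: exI[of _ "{..<n}"] simp: vertex_cover_def complement_edges_def)

section \<open>Subsets of the cover as numbers\<close>

text \<open>Numbering the vertices of \<open>C\<close> consecutively keeps all codes below
  \<open>2 ^ card C\<close>; numbering all vertices would give tables of size
  \<open>2 ^ n\<close>.\<close>

definition rank :: "nat set \<Rightarrow> nat \<Rightarrow> nat" where
  "rank C u = card (C \<inter> {..<u})"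

definition code :: "nat set \<Rightarrow> nat set \<Rightarrow> nat" where
  "code C M = (\<Sum>u\<in>M. 2 ^ rank C u)"

definition decode :: "nat set \<Rightarrow> nat \<Rightarrow> nat set" where
  "decode C x = {u \<in> C. bit x (rank C u)}"

lemma rank_0 [simp]: "rank C 0 = 0"
  by (simp add: rank_def)

lemma rank_Suc: "rank C (Suc u) = (if u \<in> C then Suc (rank C u) else rank C u)"
proof -
  have "C \<inter> {..<Suc u} = (if u \<in> C then insert u (C \<inter> {..<u}) else C \<inter> {..<u})"
    by (auto simp: less_Suc_eq)
  then show ?thesis by (simp add: rank_def)
qed

lemma rank_mono: "u \<le> v \<Longrightarrow> rank C u \<le> rank C v"
  unfolding rank_def by (intro card_mono) auto

lemma rank_strict_mono: "u < v \<Longrightarrow> u \<in> C \<Longrightarrow> rank C u < rank C v"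
  using rank_mono[of "Suc u" v C] by (simp add: rank_Suc)

lemma inj_on_rank: "inj_on (rank C) C"
  by (intro linorder_inj_onI') (use rank_strict_mono in fastforce)

lemma rank_le_card: "finite C \<Longrightarrow> rank C u \<le> card C"
  unfolding rank_def by (intro card_mono) auto

lemma rank_less_card: "finite C \<Longrightarrow> u \<in> C \<Longrightarrow> rank C u < card C"
  unfolding rank_def by (intro psubset_card_mono) auto

lemma rank_eq_card: "C \<subseteq> {..<n} \<Longrightarrow> rank C n = card C"
  unfolding rank_def by (intro arg_cong[of _ _ card]) auto

text \<open>Distinct vertices of \<open>C\<close> have distinct ranks, so the sum of powers has no
  carries.\<close>

lemma bit_code:
  assumes "finite M" "M \<subseteq> C"
  shows "bit (code C M) k \<longleftrightarrow> k \<in> rank C ` M"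
  using assms
proof (induction M arbitrary: k)
  case (insert u M)
  have "\<not> bit (code C M) (rank C u)"
    using insert inj_onD[OF inj_on_rank] by fastforce
  then have "code C (insert u M) = set_bit (rank C u) (code C M)"
    using insert by (simp add: code_def set_bit_eq)
  then show ?case using insert by (auto simp: bit_set_bit_iff)
qed (simp add: code_def)

lemma decode_code: "finite M \<Longrightarrow> M \<subseteq> C \<Longrightarrow> decode C (code C M) = M"
  using inj_onD[OF inj_on_rank] by (fastforce simp: decode_def bit_code)

lemma code_less:
  assumes "finite C" "M \<subseteq> C"
  shows "code C M < 2 ^ card C"
proof -
  have "code C M = (\<Sum>k\<in>rank C ` M. 2 ^ k)"
    unfolding code_def using inj_on_subset[OF inj_on_rank assms(2)] by (simp add: sum.reindex)
  also have "\<dots> \<le> (\<Sum>k\<in>{0..<card C}. 2 ^ k)"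
    using assms rank_less_card by (intro sum_mono2) auto
  also have "\<dots> < 2 ^ card C" by (subst sum_power2) simp
  finally show ?thesis .
qed

lemma decode_subset: "decode C x \<subseteq> C"
  by (auto simp: decode_def)

lemma power_rank_le: "v \<in> decode C x \<Longrightarrow> 2 ^ rank C v \<le> x"
  by (auto simp: decode_def bit_iff_odd intro: ccontr)

text \<open>Subtracting the weight of a set bit clears that bit. The code of \<open>M - {v}\<close>
  is therefore smaller than that of \<open>M\<close>, and the table can be filled in increasing
  order of codes.\<close>

lemma decode_remove:
  assumes "v \<in> decode C x"
  shows "decode C (x - 2 ^ rank C v) = decode C x - {v}"
proof -
  have "set_bit (rank C v) (unset_bit (rank C v) x) = x"
    using assms by (intro bit_eqI) (auto simp: decode_def bit_simps)
  then have "x = unset_bit (rank C v) x + 2 ^ rank C v"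
    by (simp add: set_bit_eq bit_unset_bit_iff)
  then have "x - 2 ^ rank C v = unset_bit (rank C v) x" by simp
  then show ?thesis
    using assms inj_onD[OF inj_on_rank] by (fastforce simp: decode_def bit_unset_bit_iff)
qed

section \<open>Reasoning about programs\<close>

text \<open>
  Unit cost together with a bound on the written values suffices for the logarithmic cost: expressions
  have constant size, so each command costs \<open>O(b)\<close> when all cells are bounded by \<open>2\<^sup>b\<close>.
  Negative write addresses protect the input.
\<close>

inductive bexec :: "int \<Rightarrow> prog \<Rightarrow> memory \<Rightarrow> nat \<Rightarrow> memory \<Rightarrow> bool" for B where
  Skip: "bexec B Skip m 1 m"
| Assign: "val a m < 0 \<Longrightarrow> \<bar>val e m\<bar> \<le> B \<Longrightarrow> bexec B (Assign a e) m 1 (m(val a m := val e m))"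
| Seq: "bexec B P m t m' \<Longrightarrow> bexec B Q m' t' m'' \<Longrightarrow> bexec B (Seq P Q) m (t + t') m''"
| If_true: "val b m > 0 \<Longrightarrow> bexec B P m t m' \<Longrightarrow> bexec B (If_pos b P Q) m (1 + t) m'"
| If_false: "\<not> val b m > 0 \<Longrightarrow> bexec B Q m t m' \<Longrightarrow> bexec B (If_pos b P Q) m (1 + t) m'"
| While_true: "val b m > 0 \<Longrightarrow> bexec B P m t m' \<Longrightarrow> bexec B (While_pos b P) m' t' m'' \<Longrightarrow>
    bexec B (While_pos b P) m (1 + t + t') m''"
| While_false: "\<not> val b m > 0 \<Longrightarrow> bexec B (While_pos b P) m 1 m"

section \<open>Conversion of bounded executions to logarithmic cost\<close>

text \<open>The weight times \<open>b\<close> is to bound both the cost and the binary length of the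
  value when all cells are at most \<open>2 ^ b\<close>. The factors 2 arise because the length of
  an operation's result is charged in addition to the cost of its operands.\<close>

fun expr_weight :: "expr \<Rightarrow> nat" where
  "expr_weight (Const c) = log_size c"
| "expr_weight (Cell a) = expr_weight a + 3"
| "expr_weight (Op f a b) = 2 * expr_weight a + 2 * expr_weight b + 3"

fun prog_weight :: "prog \<Rightarrow> nat" where
  "prog_weight Skip = 1"
| "prog_weight (Assign a e) = 1 + expr_weight a + expr_weight e"
| "prog_weight (Seq P Q) = prog_weight P + prog_weight Q"
| "prog_weight (If_pos b P Q) = 1 + expr_weight b + prog_weight P + prog_weight Q"
| "prog_weight (While_pos b P) = 1 + expr_weight b + prog_weight P"

lemma log_size_le: "\<bar>x\<bar> \<le> 2 ^ k \<Longrightarrow> log_size x \<le> k + 2"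
proof -
  assume "\<bar>x\<bar> \<le> 2 ^ k"
  then have "\<bar>x\<bar> < 2 ^ (k + 1)" using zero_less_power[of "2::int" k] by (simp del: zero_less_power)
  then have "bitlen \<bar>x\<bar> \<le> int (k + 1)" by (intro bitlen_le_iff_power[THEN iffD2]) (simp add: nat_add_distrib)
  then show ?thesis by (simp add: log_size_def)
qed

lemma abs_le_power_log_size: "\<bar>x\<bar> \<le> 2 ^ log_size x"
proof -
  have "\<bar>x\<bar> < 2 ^ nat (bitlen \<bar>x\<bar>)"
    using bitlen_le_iff_power[of "\<bar>x\<bar>" "bitlen \<bar>x\<bar>"] by simp
  also have "\<dots> \<le> 2 ^ log_size x" by (intro power_increasing) (auto simp: log_size_def)
  finally show ?thesis by simp
qed

text \<open>Products add the lengths, sums and differences take one further bit, and division does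
  not increase the absolute value, division by zero being 0.\<close>

lemma abs_apply_op_le:
  assumes "\<bar>x\<bar> \<le> 2 ^ i" "\<bar>y\<bar> \<le> 2 ^ j"
  shows "\<bar>apply_op f x y\<bar> \<le> 2 ^ (i + j + 1)"
proof -
  have *: "(2::int) ^ i \<le> 2 ^ (i + j)" "(2::int) ^ j \<le> 2 ^ (i + j)" by (intro power_increasing; simp)+
  have "(2::int) ^ (i + j + 1) = 2 ^ (i + j) + 2 ^ (i + j)" by simp
  then have sum: "\<bar>x\<bar> + \<bar>y\<bar> \<le> 2 ^ (i + j + 1)" using assms * by linarith
  show ?thesis
  proof (cases f)
    case Times
    have "\<bar>x\<bar> * \<bar>y\<bar> \<le> 2 ^ i * 2 ^ j" using assms by (intro mult_mono) auto
    then have "\<bar>x * y\<bar> \<le> 2 ^ (i + j)" by (simp add: abs_mult power_add)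
    then show ?thesis using Times by simp
  next
    case Div
    have "\<bar>x div y\<bar> \<le> \<bar>x\<bar>"
      by (smt (verit) div_by_0 div_minus_right div_by_1 div_neg_pos_less0 zdiv_mono2 zdiv_mono2_neg
          div_nonneg_neg_le0 pos_imp_zdiv_nonneg_iff)
    then show ?thesis unfolding Div apply_op.simps using sum by linarith
  next
    case Plus
    show ?thesis unfolding Plus apply_op.simps using sum by linarith
  next
    case Minus
    show ?thesis unfolding Minus apply_op.simps using sum by linarith
  qed
qed

lemma expr_cost_le:
  assumes "\<And>a. \<bar>m a\<bar> \<le> 2 ^ b" "1 \<le> b"
  shows "expr_cost e m \<le> expr_weight e * b \<and> \<bar>val e m\<bar> \<le> 2 ^ (expr_weight e * b)"
proof (induction e)
  case (Const c)
  have "log_size c \<le> log_size c * b" using assms by simp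
  moreover have "\<bar>c\<bar> \<le> 2 ^ (log_size c * b)"
    using abs_le_power_log_size[of c] power_increasing[OF calculation, of "2::int"] by linarith
  ultimately show ?case by simp
next
  case (Cell a)
  \<comment> \<open>The content read is bounded by \<open>2 ^ b\<close> wherever the address points,
    and \<open>b + 2 \<le> 3 * b\<close>.\<close>
  have "log_size (m (val a m)) \<le> b + 2" using assms by (intro log_size_le) auto
  moreover have "(2::int) ^ b \<le> 2 ^ ((expr_weight a + 3) * b)"
    by (intro power_increasing) (auto simp: algebra_simps)
  moreover have "\<bar>m (val a m)\<bar> \<le> 2 ^ b" by (rule assms)
  ultimately have "\<bar>m (val a m)\<bar> \<le> 2 ^ ((expr_weight a + 3) * b)" by linarith
  moreover have "expr_cost a m + log_size (m (val a m)) \<le> (expr_weight a + 3) * b"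
    using Cell assms(2) \<open>log_size (m (val a m)) \<le> b + 2\<close> by (simp add: algebra_simps)
  ultimately show ?case by simp
next
  case (Op f x y)
  let ?i = "expr_weight x * b" and ?j = "expr_weight y * b"
  have v: "\<bar>apply_op f (val x m) (val y m)\<bar> \<le> 2 ^ (?i + ?j + 1)"
    using Op by (intro abs_apply_op_le) auto
  also have "\<dots> \<le> 2 ^ (expr_weight (Op f x y) * b)"
    using assms(2) by (intro power_increasing) (auto simp: algebra_simps)
  finally have 1: "\<bar>val (Op f x y) m\<bar> \<le> 2 ^ (expr_weight (Op f x y) * b)" by simp
  have "log_size (apply_op f (val x m) (val y m)) \<le> ?i + ?j + 1 + 2"
    using v by (rule log_size_le)
  then have "expr_cost (Op f x y) m \<le> 2 * ?i + 2 * ?j + 3" using Op by simp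
  also have "\<dots> \<le> expr_weight (Op f x y) * b" using assms(2) by (simp add: algebra_simps)
  finally show ?case using 1 by blast
qed

text \<open>A counted step evaluates expressions of the program in a memory bounded by
  \<open>2 ^ b\<close>, and the bound on written values preserves this property.\<close>

lemma exec_of_bexec:
  assumes "bexec (2 ^ b) P m s m'" "\<And>a. \<bar>m a\<bar> \<le> 2 ^ b" "1 \<le> b"
  shows "\<exists>t. exec P m t m' \<and> t \<le> s * (prog_weight P * b) \<and> (\<forall>a. \<bar>m' a\<bar> \<le> 2 ^ b)"
  using assms(1,2)
proof induction
  case (Skip m)
  then show ?case using exec_Skip[of m] assms(3) by auto
next
  case (Assign a m e)
  have "1 + expr_cost a m + expr_cost e m \<le> 1 * (prog_weight (Assign a e) * b)"
    using expr_cost_le[of m b a] expr_cost_le[of m b e] Assign assms(3) by (simp add: algebra_simps)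
  moreover have "\<bar>(m(val a m := val e m)) x\<bar> \<le> 2 ^ b" for x using Assign by simp
  ultimately show ?case using exec_Assign[of a e m] by blast
next
  case (Seq P m t m' Q t' m'')
  obtain u where u: "exec P m u m'" "u \<le> t * (prog_weight P * b)" "\<And>a. \<bar>m' a\<bar> \<le> 2 ^ b"
    using Seq.IH(1) Seq.prems by blast
  obtain v where v: "exec Q m' v m''" "v \<le> t' * (prog_weight Q * b)" "\<And>a. \<bar>m'' a\<bar> \<le> 2 ^ b"
    using Seq.IH(2) u(3) by blast
  have "u + v \<le> (t + t') * (prog_weight (Seq P Q) * b)" using u v by (simp add: algebra_simps)
  then show ?case using exec_Seq[OF u(1) v(1)] v(3) by blast
next
  case (If_true c m P t m' Q)
  obtain u where u: "exec P m u m'" "u \<le> t * (prog_weight P * b)" "\<And>a. \<bar>m' a\<bar> \<le> 2 ^ b"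
    using If_true by blast
  have "1 + expr_cost c m + u \<le> (1 + t) * (prog_weight (If_pos c P Q) * b)"
    using u expr_cost_le[of m b c] If_true.prems assms(3) by (simp add: algebra_simps)
  then show ?case using exec_If_true[OF If_true.hyps(1) u(1)] u(3) by blast
next
  case (If_false c m Q t m' P)
  obtain u where u: "exec Q m u m'" "u \<le> t * (prog_weight Q * b)" "\<And>a. \<bar>m' a\<bar> \<le> 2 ^ b"
    using If_false by blast
  have "1 + expr_cost c m + u \<le> (1 + t) * (prog_weight (If_pos c P Q) * b)"
    using u expr_cost_le[of m b c] If_false.prems assms(3) by (simp add: algebra_simps)
  then show ?case using exec_If_false[OF If_false.hyps(1) u(1)] u(3) by blast
next
  case (While_true c m P t m' t' m'')
  obtain u where u: "exec P m u m'" "u \<le> t * (prog_weight P * b)" "\<And>a. \<bar>m' a\<bar> \<le> 2 ^ b"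
    using While_true.IH(1) While_true.prems by blast
  obtain v where v: "exec (While_pos c P) m' v m''" "v \<le> t' * (prog_weight (While_pos c P) * b)"
    "\<And>a. \<bar>m'' a\<bar> \<le> 2 ^ b"
    using While_true.IH(2) u(3) by blast
  have "1 + expr_cost c m + u + v \<le> (1 + t + t') * (prog_weight (While_pos c P) * b)"
    using u v expr_cost_le[of m b c] While_true.prems assms(3) by (simp add: algebra_simps)
  then show ?case using exec_While_true[OF While_true.hyps(1) u(1) v(1)] v(3) by blast
next
  case (While_false c m P)
  have "1 + expr_cost c m \<le> 1 * (prog_weight (While_pos c P) * b)"
    using expr_cost_le[of m b c] While_false.prems assms(3) by (simp add: algebra_simps)
  then show ?case using exec_While_false[OF While_false.hyps] While_false.prems by blast
qed

text \<open>
  Negative addresses hold the working memory, split into 32 arrays indexed from \<open>0\<close>; a scalar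
  variable is the entry \<open>0\<close> of its array.
\<close>

definition addr :: "int \<Rightarrow> int \<Rightarrow> int" where
  "addr l i = - l - 32 * i"

definition Addr :: "int \<Rightarrow> expr \<Rightarrow> expr" where
  "Addr l e = Op Minus (Const (- l)) (Op Times (Const 32) e)"

abbreviation Arr :: "int \<Rightarrow> expr \<Rightarrow> expr" where
  "Arr l e \<equiv> Cell (Addr l e)"

abbreviation Var :: "int \<Rightarrow> expr" where
  "Var l \<equiv> Arr l (Const 0)"

abbreviation Set_arr :: "int \<Rightarrow> expr \<Rightarrow> expr \<Rightarrow> prog" where
  "Set_arr l i e \<equiv> Assign (Addr l i) e"

abbreviation Set_var :: "int \<Rightarrow> expr \<Rightarrow> prog" where
  "Set_var l e \<equiv> Set_arr l (Const 0) e"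

lemma val_Addr [simp]: "val (Addr l e) m = addr l (val e m)"
  by (simp add: Addr_def addr_def)

text \<open>The array number is the residue modulo 32 of the negated address.\<close>

lemma addr_eq_iff:
  assumes "0 \<le> l" "l < 32" "0 \<le> l'" "l' < 32"
  shows "addr l i = addr l' i' \<longleftrightarrow> l = l' \<and> i = i'"
proof -
  have "l' = l" if "l' + 32 * i' = l + 32 * i"
  proof -
    have "(l' + 32 * i') mod 32 = l'" "(l + 32 * i) mod 32 = l" using assms by auto
    with that show ?thesis by simp
  qed
  then show ?thesis by (auto simp: addr_def)
qed

text \<open>With numerals as array numbers the simplifier decides the ranges and all comparisons by
  itself.\<close>

lemma addr_eq_numeral [simp]:
  "numeral l < (32::int) \<Longrightarrow> numeral l' < (32::int) \<Longrightarrow>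
    addr (numeral l) i = addr (numeral l') i' \<longleftrightarrow> (numeral l :: int) = numeral l' \<and> i = i'"
  by (rule addr_eq_iff) auto

lemma addr_neg [simp]: "0 < l \<Longrightarrow> 0 \<le> i \<Longrightarrow> addr l i < 0"
  by (simp add: addr_def)

lemma Addr_eq [simp]: "Addr l e = Addr l' e' \<longleftrightarrow> l = l' \<and> e = e'"
  by (auto simp: Addr_def)

section \<open>Frame conditions and step-bounded correctness\<close>

primrec writes :: "int set \<Rightarrow> prog \<Rightarrow> bool" where
  "writes A Skip = True"
| "writes A (Assign a e) = (\<exists>l\<in>A. 0 \<le> l \<and> l < 32 \<and> (\<exists>i. a = Addr l i))"
| "writes A (Seq P Q) = (writes A P \<and> writes A Q)"
| "writes A (If_pos b P Q) = (writes A P \<and> writes A Q)"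
| "writes A (While_pos b P) = writes A P"

lemma writes_Set_arr [simp]: "writes A (Set_arr l i e) \<longleftrightarrow> l \<in> A \<and> 0 \<le> l \<and> l < 32"
  by auto

declare writes.simps(2) [simp del]

text \<open>Frame relation: the input at non-negative addresses and the arrays outside
  \<open>A\<close> are unchanged.\<close>

definition agree :: "int set \<Rightarrow> memory \<Rightarrow> memory \<Rightarrow> bool" where
  "agree A m m' \<longleftrightarrow> (\<forall>a\<ge>0. m' a = m a) \<and>
    (\<forall>l i. 0 \<le> l \<and> l < 32 \<and> l \<notin> A \<longrightarrow> m' (addr l i) = m (addr l i))"

lemma agree_refl [simp]: "agree A m m"
  by (simp add: agree_def)

lemma agree_trans: "agree A m m' \<Longrightarrow> agree A m' m'' \<Longrightarrow> agree A m m''"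
  by (simp add: agree_def)

lemma agree_mono: "agree A m m' \<Longrightarrow> A \<subseteq> A' \<Longrightarrow> agree A' m m'"
  by (auto simp: agree_def)

lemma agree_addr:
  "agree A m m' \<Longrightarrow> 0 \<le> l \<Longrightarrow> l < 32 \<Longrightarrow> l \<notin> A \<Longrightarrow> m' (addr l i) = m (addr l i)"
  by (simp add: agree_def)

lemma agree_input: "agree A m m' \<Longrightarrow> 0 \<le> a \<Longrightarrow> m' a = m a"
  by (simp add: agree_def)

lemma bexec_agree: "bexec B P m t m' \<Longrightarrow> writes A P \<Longrightarrow> agree A m m'"
proof (induction rule: bexec.induct)
  case (Assign a m e)
  then obtain l i where "l \<in> A" "0 \<le> l" "l < 32" "a = Addr l i" by (auto simp: writes.simps(2))
  with Assign(1) show ?case by (auto simp: agree_def addr_eq_iff)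
qed (auto intro: agree_trans)

text \<open>Total correctness from a fixed start memory, with a budget of \<open>s\<close>
  steps.\<close>

definition run :: "int \<Rightarrow> prog \<Rightarrow> memory \<Rightarrow> nat \<Rightarrow> (memory \<Rightarrow> bool) \<Rightarrow> bool" where
  "run B P m s Q \<longleftrightarrow> (\<exists>s' m'. bexec B P m s' m' \<and> s' \<le> s \<and> Q m')"

lemma run_weaken:
  "run B P m s Q \<Longrightarrow> s \<le> s' \<Longrightarrow> (\<And>m'. Q m' \<Longrightarrow> Q' m') \<Longrightarrow> run B P m s' Q'"
  unfolding run_def by (meson le_trans)

lemma run_Seq:
  assumes "run B P m s Q" "\<And>m'. Q m' \<Longrightarrow> run B P' m' s' Q'"
  shows "run B (Seq P P') m (s + s') Q'"
  using assms unfolding run_def by (meson add_mono bexec.Seq)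

lemma run_agree:
  assumes "run B P m s Q" "writes A P"
  shows "run B P m s (\<lambda>m'. Q m' \<and> agree A m m')"
  using assms bexec_agree unfolding run_def by blast

text \<open>Here \<open>k\<close> counts finished iterations and exactly \<open>N\<close> are made,
  each costing \<open>s\<close> and one evaluation of the guard. The frame relation to the start
  memory is available in the body.\<close>

lemma run_While:
  assumes "I (0::nat) m" "writes A P"
    and body: "\<And>k m'. k < N \<Longrightarrow> I k m' \<Longrightarrow> agree A m m' \<Longrightarrow> 0 < val b m' \<and> run B P m' s (I (Suc k))"
    and exit: "\<And>m'. I N m' \<Longrightarrow> agree A m m' \<Longrightarrow> \<not> 0 < val b m'"
  shows "run B (While_pos b P) m ((N + 1) * (s + 1)) (\<lambda>m'. I N m' \<and> agree A m m')"
proof -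
  have "run B (While_pos b P) m' ((N - k) * (s + 1) + 1) (\<lambda>m'. I N m' \<and> agree A m m')"
    if "k \<le> N" "I k m'" "agree A m m'" for k m'
    using that
  proof (induction "N - k" arbitrary: k m')
    case 0
    then have "I N m'" by simp
    then show ?case using exit 0 bexec.While_false[of b m' B P] unfolding run_def by auto
  next
    case (Suc d)
    then have k: "k < N" by simp
    have b: "0 < val b m'" and "run B P m' s (I (Suc k))" using body[OF k] Suc.prems by auto
    then obtain t m1 where 1: "bexec B P m' t m1" "t \<le> s" "I (Suc k) m1"
      unfolding run_def by blast
    have "agree A m m1" using bexec_agree[OF 1(1) assms(2)] Suc.prems agree_trans by blast
    then have "run B (While_pos b P) m1 ((N - Suc k) * (s + 1) + 1) (\<lambda>m'. I N m' \<and> agree A m m')"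
      using Suc 1 k by (intro Suc.hyps(1)) auto
    then obtain t' m2 where 2: "bexec B (While_pos b P) m1 t' m2" "t' \<le> (N - Suc k) * (s + 1) + 1"
      "I N m2" "agree A m m2" unfolding run_def by blast
    have "(N - k) * (s + 1) = (N - Suc k) * (s + 1) + (s + 1)"
      using k by (metis Suc_diff_Suc add.commute mult_Suc)
    then have "1 + t + t' \<le> (N - k) * (s + 1) + 1" using 1 2 by linarith
    then show ?case using bexec.While_true[OF b 1(1) 2(1)] 2 unfolding run_def by blast
  qed
  from this[of 0 m] have "run B (While_pos b P) m (N * (s + 1) + 1) (\<lambda>m'. I N m' \<and> agree A m m')"
    using assms(1) by simp
  then show ?thesis by (rule run_weaken) auto
qed

text \<open>Weakest preconditions of loop-free programs; loops are mapped to \<open>False\<close>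
  and treated by \<open>run_While\<close>.\<close>

fun wp :: "int \<Rightarrow> prog \<Rightarrow> (memory \<Rightarrow> bool) \<Rightarrow> memory \<Rightarrow> bool" where
  "wp B Skip Q m \<longleftrightarrow> Q m"
| "wp B (Assign a e) Q m \<longleftrightarrow> val a m < 0 \<and> \<bar>val e m\<bar> \<le> B \<and> Q (m(val a m := val e m))"
| "wp B (Seq P P') Q m \<longleftrightarrow> wp B P (wp B P' Q) m"
| "wp B (If_pos b P P') Q m \<longleftrightarrow> (if 0 < val b m then wp B P Q m else wp B P' Q m)"
| "wp B (While_pos b P) Q m \<longleftrightarrow> False"

fun prog_size :: "prog \<Rightarrow> nat" where
  "prog_size (Seq P Q) = prog_size P + prog_size Q"
| "prog_size (If_pos b P Q) = 1 + prog_size P + prog_size Q"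
| "prog_size _ = 1"

lemma run_wp: "wp B P Q m \<Longrightarrow> run B P m (prog_size P) Q"
proof (induction P arbitrary: Q m)
  case Skip
  then show ?case unfolding run_def using bexec.Skip by fastforce
next
  case (Assign a e)
  then show ?case unfolding run_def using bexec.Assign by fastforce
next
  case (Seq P P')
  have "run B P m (prog_size P) (wp B P' Q)" using Seq by simp
  from run_Seq[OF this Seq.IH(2)] show ?case by simp
next
  case (If_pos b P P')
  show ?case
  proof (cases "0 < val b m")
    case True
    then have "run B P m (prog_size P) Q" using If_pos by simp
    then obtain s' m' where "bexec B P m s' m'" "s' \<le> prog_size P" "Q m'" unfolding run_def by blast
    then show ?thesis using bexec.If_true[OF True] unfolding run_def by fastforce
  next
    case False
    then have "run B P' m (prog_size P') Q" using If_pos by simp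
    then obtain s' m' where "bexec B P' m s' m'" "s' \<le> prog_size P'" "Q m'" unfolding run_def by blast
    then show ?thesis using bexec.If_false[OF False] unfolding run_def by fastforce
  qed
qed simp

lemma addr_nonneg_neq [simp]:
  "0 < l \<Longrightarrow> 0 \<le> i \<Longrightarrow> 0 \<le> a \<Longrightarrow> addr l i \<noteq> a"
  "0 < l \<Longrightarrow> 0 \<le> i \<Longrightarrow> 0 \<le> a \<Longrightarrow> a \<noteq> addr l i"
  using addr_neg[of l i] by linarith+

section \<open>Arrays and sets held in memory\<close>

definition stores :: "int \<Rightarrow> nat \<Rightarrow> (nat \<Rightarrow> int) \<Rightarrow> memory \<Rightarrow> bool" where
  "stores l N f m \<longleftrightarrow> (\<forall>i<N. m (addr l (int i)) = f i)"

lemma storesD: "stores l N f m \<Longrightarrow> i < N \<Longrightarrow> m (addr l (int i)) = f i"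
  by (simp add: stores_def)

lemma stores_0 [simp]: "stores l 0 f m"
  by (simp add: stores_def)

lemma stores_upd_other [simp]:
  "numeral l < (32::int) \<Longrightarrow> numeral l' < (32::int) \<Longrightarrow> (numeral l :: int) \<noteq> numeral l' \<Longrightarrow>
    stores (numeral l) N f (m(addr (numeral l') i := x)) = stores (numeral l) N f m"
  by (simp add: stores_def)

lemma stores_Suc [simp]:
  "numeral l < (32::int) \<Longrightarrow>
    stores (numeral l) (Suc N) f (m(addr (numeral l) (int N) := x)) \<longleftrightarrow>
    stores (numeral l) N f m \<and> x = f N"
  by (auto simp: stores_def less_Suc_eq)

definition stores_set :: "int \<Rightarrow> nat \<Rightarrow> nat set \<Rightarrow> memory \<Rightarrow> bool" where
  "stores_set l N S = stores l N (\<lambda>i. of_bool (i \<in> S))"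

lemma stores_setD: "stores_set l N S m \<Longrightarrow> i < N \<Longrightarrow> m (addr l (int i)) = of_bool (i \<in> S)"
  by (simp add: stores_set_def stores_def)

lemma stores_set_0 [simp]: "stores_set l 0 S m"
  by (simp add: stores_set_def)

lemma stores_set_upd_other [simp]:
  "numeral l < (32::int) \<Longrightarrow> numeral l' < (32::int) \<Longrightarrow> (numeral l :: int) \<noteq> numeral l' \<Longrightarrow>
    stores_set (numeral l) N S (m(addr (numeral l') i := x)) = stores_set (numeral l) N S m"
  by (simp add: stores_set_def)

lemma stores_set_Suc [simp]:
  "numeral l < (32::int) \<Longrightarrow>
    stores_set (numeral l) (Suc N) S (m(addr (numeral l) (int N) := x)) \<longleftrightarrow>
    stores_set (numeral l) N S m \<and> x = of_bool (N \<in> S)"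
  by (simp add: stores_set_def)

lemma stores_set_insert:
  "numeral l < (32::int) \<Longrightarrow> stores_set (numeral l) N S m \<Longrightarrow>
    stores_set (numeral l) N (insert v S) (m(addr (numeral l) (int v) := 1))"
  by (simp add: stores_set_def stores_def)

lemma stores_set_agree:
  "stores_set l N S m \<Longrightarrow> agree A m m' \<Longrightarrow> 0 \<le> l \<Longrightarrow> l < 32 \<Longrightarrow> l \<notin> A \<Longrightarrow> stores_set l N S m'"
  by (simp add: stores_set_def stores_def agree_addr)

lemma stores_agree:
  "stores l N f m \<Longrightarrow> agree A m m' \<Longrightarrow> 0 \<le> l \<Longrightarrow> l < 32 \<Longrightarrow> l \<notin> A \<Longrightarrow> stores l N f m'"
  by (simp add: stores_def agree_addr)

abbreviation plus_expr (infixl "\<oplus>" 65) where "a \<oplus> b \<equiv> Op Plus a b"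
abbreviation minus_expr (infixl "\<ominus>" 65) where "a \<ominus> b \<equiv> Op Minus a b"
abbreviation times_expr (infixl "\<otimes>" 70) where "a \<otimes> b \<equiv> Op Times a b"
abbreviation div_expr (infixl "\<oslash>" 70) where "a \<oslash> b \<equiv> Op Div a b"
notation Seq (infixr ";;" 55)

abbreviation parity :: "expr \<Rightarrow> expr" where
  "parity e \<equiv> e \<ominus> Const 2 \<otimes> (e \<oslash> Const 2)"

definition For :: "int \<Rightarrow> expr \<Rightarrow> prog \<Rightarrow> prog" where
  "For l e P = Set_var l (Const 0);;
    While_pos (e \<ominus> Var l) (P;; Set_var l (Var l \<oplus> Const 1))"

lemma writes_For [simp]: "writes A (For l e P) \<longleftrightarrow> l \<in> A \<and> 0 \<le> l \<and> l < 32 \<and> writes A P"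
  by (auto simp: For_def)

lemma writes_mono: "writes A P \<Longrightarrow> A \<subseteq> A' \<Longrightarrow> writes A' P"
  by (induction P) (auto simp: writes.simps(2))

text \<open>The invariant must be insensitive to the counter cell (\<open>inert\<close>), so that it
  survives initialisation and increment. The summand 3 pays for guard, increment and a share of the
  initialisation.\<close>

lemma run_For:
  assumes l: "0 < l" "l < 32" "l \<notin> A" and A: "writes A P"
    and bound: "\<And>m'. agree (insert l A) m m' \<Longrightarrow> val e m' = int N" "int N \<le> B"
    and inert: "\<And>k m' x. I k m' \<Longrightarrow> I k (m'(addr l 0 := x))"
    and start: "I 0 m"
    and body: "\<And>k m'. k < N \<Longrightarrow> I k m' \<Longrightarrow> agree (insert l A) m m' \<Longrightarrow> m' (addr l 0) = int k \<Longrightarrow>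
      run B P m' s (I (Suc k))"
  shows "run B (For l e P) m ((N + 1) * (s + 3)) (\<lambda>m'. I N m' \<and> agree (insert l A) m m')"
proof -
  let ?A = "insert l A" and ?m = "m(addr l 0 := 0)"
  let ?I = "\<lambda>k m'. I k m' \<and> m' (addr l 0) = int k"
  have A': "writes ?A P" using A by (rule writes_mono) auto
  have "wp B (Set_var l (Const 0)) (\<lambda>m'. m' = ?m) m"
    using l bound(2) by simp
  from run_wp[OF this] have 1: "run B (Set_var l (Const 0)) m 1 (\<lambda>m'. m' = ?m)" by simp
  have agr: "agree ?A m ?m" using l by (auto simp: agree_def addr_eq_iff)
  have "run B (While_pos (e \<ominus> Var l) (P;; Set_var l (Var l \<oplus> Const 1))) ?m ((N + 1) * (s + 1 + 1))
      (\<lambda>m'. ?I N m' \<and> agree ?A ?m m')"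
  proof (rule run_While)
    show "?I 0 ?m" using inert[OF start] by simp
    show "writes ?A (P;; Set_var l (Var l \<oplus> Const 1))" using A' l by simp
  next
    fix k m' assume k: "k < N" and I: "?I k m'" and a: "agree ?A ?m m'"
    have a': "agree ?A m m'" using agr a by (rule agree_trans)
    have "run B P m' s (\<lambda>m''. I (Suc k) m'' \<and> agree A m' m'')"
      using body[OF k _ a'] I A by (intro run_agree) auto
    then have "run B P m' s (\<lambda>m''. I (Suc k) m'' \<and> m'' (addr l 0) = int k)"
      using l I by (elim run_weaken) (auto simp: agree_addr)
    then have "run B (P;; Set_var l (Var l \<oplus> Const 1)) m' (s + 1) (?I (Suc k))"
    proof (rule run_Seq)
      fix m'' assume "I (Suc k) m'' \<and> m'' (addr l 0) = int k"
      then have "wp B (Set_var l (Var l \<oplus> Const 1)) (?I (Suc k)) m''"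
        using l k bound(2) inert by simp
      from run_wp[OF this] show "run B (Set_var l (Var l \<oplus> Const 1)) m'' 1 (?I (Suc k))" by simp
    qed
    then show "0 < val (e \<ominus> Var l) m' \<and> run B (P;; Set_var l (Var l \<oplus> Const 1)) m' (s + 1) (?I (Suc k))"
      using bound(1)[OF a'] k I by simp
  next
    fix m' assume "?I N m'" "agree ?A ?m m'"
    then show "\<not> 0 < val (e \<ominus> Var l) m'" using bound(1)[OF agree_trans[OF agr]] by simp
  qed
  then have "run B (For l e P) m (1 + (N + 1) * (s + 1 + 1)) (\<lambda>m'. ?I N m' \<and> agree ?A ?m m')"
    unfolding For_def by (intro run_Seq[OF 1]) auto
  then show ?thesis by (rule run_weaken) (use agree_trans[OF agr] in \<open>auto simp: algebra_simps\<close>)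
qed

lemma half_less_iff_odd: "2 * int (k div 2) < int k \<longleftrightarrow> odd k"
  by presburger

lemma run_wp_agree:
  "wp B P Q m \<Longrightarrow> writes A P \<Longrightarrow> prog_size P \<le> s \<Longrightarrow>
    run B P m s (\<lambda>m'. Q m' \<and> agree A m m')"
  by (rule run_weaken[OF run_agree[OF run_wp]]) auto

section \<open>The program\<close>

abbreviation size_n :: expr where "size_n \<equiv> Cell (Const 0)"

text \<open>
  Scalars: \<open>2\<close> guide, \<open>3\<close> its unread bits, \<open>4\<close> matrix index, \<open>5\<close> and \<open>6\<close> vertices, \<open>7\<close> number of
  subsets of the cover \<open>C\<close>, \<open>8\<close> tested bag size, \<open>9\<close> success flag, \<open>10\<close> code of the current subset \<open>M\<close>,
  \<open>11\<close> its unread bits, \<open>12\<close> weight of the current bit, \<open>13\<close> size of \<open>M\<close>, \<open>14\<close> best proper subset,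
  \<open>15\<close> size of \<open>N[M]\<close>, \<open>16\<close> code of \<open>C - N[M]\<close>, \<open>17\<close> whether a vertex lies in \<open>N[M]\<close>.
  Arrays: \<open>18\<close> indicator of \<open>C\<close>, \<open>19\<close> indicator of \<open>M\<close>, \<open>20\<close> to \<open>22\<close>, indexed by the code of \<open>M\<close>:
  \<open>best\<close>, size of \<open>M\<close>, code of \<open>C - N[M]\<close>.
\<close>

definition clear_marks :: prog where
  "clear_marks = For 5 size_n (Set_arr 18 (Var 5) (Const 0))"

text \<open>The guard multiplies \<open>v - u\<close> by three factors from {0, 1}, so it is
  positive iff \<open>u < v\<close>, the pair is a non-edge and both endpoints are unmarked.\<close>

definition branch_step :: prog where
  "branch_step =
    Set_var 5 (Var 4 \<oslash> size_n);; Set_var 6 (Var 4 \<ominus> size_n \<otimes> Var 5);;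
    If_pos ((Var 6 \<ominus> Var 5) \<otimes> (Const 1 \<ominus> Cell (Const 1 \<oplus> Var 4)) \<otimes>
        (Const 1 \<ominus> Arr 18 (Var 5)) \<otimes> (Const 1 \<ominus> Arr 18 (Var 6)))
      (If_pos (parity (Var 3)) (Set_arr 18 (Var 5) (Const 1)) (Set_arr 18 (Var 6) (Const 1));;
       Set_var 3 (Var 3 \<oslash> Const 2))
      Skip"

text \<open>The guide is incremented before each scan, so 1 is the first one tried; the rest 0 in
  the fresh memory makes the loop start.\<close>

definition cover_phase :: prog where
  "cover_phase = While_pos (Const 1 \<ominus> Var 3)
    ((Set_var 2 (Var 2 \<oplus> Const 1);; Set_var 3 (Var 2));; clear_marks;;
     For 4 (size_n \<otimes> size_n) branch_step)"

definition count_phase :: prog where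
  "count_phase = Set_var 7 (Const 1);;
    For 5 size_n (If_pos (Arr 18 (Var 5)) (Set_var 7 (Const 2 \<otimes> Var 7)) Skip)"

text \<open>For a vertex \<open>v\<close> of \<open>M\<close>,
  \<open>Var 10 \<ominus> Var 12\<close> is the code of \<open>M - {v}\<close>, so one scan yields
  \<open>M\<close>, its size and the best value after a removal.\<close>

definition decode_step :: prog where
  "decode_step = Set_arr 19 (Var 5) (Const 0);;
    If_pos (Arr 18 (Var 5))
      (If_pos (parity (Var 11))
         (Set_arr 19 (Var 5) (Const 1);; Set_var 13 (Var 13 \<oplus> Const 1);;
          If_pos (Arr 20 (Var 10 \<ominus> Var 12) \<ominus> Var 14) (Set_var 14 (Arr 20 (Var 10 \<ominus> Var 12))) Skip)
         Skip;;
       Set_var 11 (Var 11 \<oslash> Const 2);; Set_var 12 (Const 2 \<otimes> Var 12))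
      Skip"

definition decode_loop :: prog where
  "decode_loop = (Set_var 11 (Var 10);; Set_var 12 (Const 1);; Set_var 13 (Const 0);; Set_var 14 (Const 0));;
    For 5 size_n decode_step"

definition nbhd_step :: prog where
  "nbhd_step = Set_var 17 (Arr 19 (Var 5));;
    For 6 size_n (If_pos (Arr 19 (Var 6) \<otimes> Cell (Const 1 \<oplus> (Var 5 \<otimes> size_n \<oplus> Var 6)))
      (Set_var 17 (Const 1)) Skip);;
    (Set_var 15 (Var 15 \<oplus> Var 17);;
     If_pos (Arr 18 (Var 5))
       (Set_var 16 (Var 16 \<oplus> Var 12 \<otimes> (Const 1 \<ominus> Var 17));; Set_var 12 (Const 2 \<otimes> Var 12))
       Skip)"

definition nbhd_loop :: prog where
  "nbhd_loop = (Set_var 12 (Const 1);; Set_var 15 (Const 0);; Set_var 16 (Const 0));;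
    For 5 size_n nbhd_step"

text \<open>The two nested tests are the two conditions of \<open>best_rec\<close>, with offsets
  that turn them into positivity tests.\<close>

definition table_step :: prog where
  "table_step = decode_loop;; nbhd_loop;;
    (If_pos (Var 14 \<ominus> Var 13 \<oplus> Const 2)
      (If_pos (Var 8 \<oplus> Var 13 \<ominus> Var 15) (Set_arr 20 (Var 10) (Var 13)) (Set_arr 20 (Var 10) (Var 14)))
      (Set_arr 20 (Var 10) (Var 14));;
     Set_arr 21 (Var 10) (Var 13);; Set_arr 22 (Var 10) (Var 16))"

definition check_step :: prog where
  "check_step = If_pos (Arr 20 (Var 10) \<ominus> Arr 21 (Var 10) \<oplus> Const 1)
    (If_pos (Arr 20 (Arr 22 (Var 10)) \<oplus> Arr 21 (Var 10) \<oplus> Var 8 \<ominus> size_n \<oplus> Const 1)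
      (Set_var 9 (Const 1)) Skip) Skip"

text \<open>The bag size is incremented after its test, so the final value is one more than the
  least feasible size.\<close>

definition width_phase :: prog where
  "width_phase = While_pos (Const 1 \<ominus> Var 9)
    (For 10 (Var 7) table_step;; For 10 (Var 7) check_step;; Set_var 8 (Var 8 \<oplus> Const 1))"

section \<open>Correctness and running time of the cover search\<close>

text \<open>The bound \<open>B\<close> leaves room for \<open>n * n\<close>, for all guides tried
  and for all codes of subsets, while its binary length is linear in \<open>n\<close>.\<close>

locale graph_memory =
  fixes n :: nat and E :: "nat set set" and B :: int
  assumes G: "simple_graph {..<n} E" and B_def: "B = 2 ^ (2 * n + 3)"
begin

definition input :: "memory \<Rightarrow> bool" where
  "input m \<longleftrightarrow> m 0 = int n \<and> (\<forall>u<n. \<forall>v<n. m (1 + (int u * int n + int v)) = of_bool ({u, v} \<in> E))"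

lemma input_graph_input: "input (graph_input n E)"
  unfolding input_def
proof (intro conjI allI impI)
  fix u v assume uv: "u < n" "v < n"
  \<comment> \<open>Row and column are recovered from a matrix index as quotient and remainder by
    \<open>n\<close>.\<close>
  have "u' = u \<and> v' = v" if "v' < n" "u * n + v = u' * n + v'" for u' v'
  proof -
    have *: "(a * n + b) div n = a" "(a * n + b) mod n = b" if "b < n" for a b using that by auto
    show ?thesis using *[OF uv(2), of u] *[OF that(1), of u'] that(2) by simp
  qed
  then have "(\<exists>u'<n. \<exists>v'<n. 1 + (int u * int n + int v) = 1 + int u' * int n + int v' \<and> {u', v'} \<in> E)
      \<longleftrightarrow> {u, v} \<in> E"
    using uv by (auto simp flip: of_nat_mult of_nat_add)
  then show "graph_input n E (1 + (int u * int n + int v)) = of_bool ({u, v} \<in> E)"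
    unfolding graph_input_def by (auto simp: add_nonneg_eq_0_iff)
qed (simp add: graph_input_def)

lemma input_agree: "input m \<Longrightarrow> agree A m m' \<Longrightarrow> input m'"
  by (simp add: input_def agree_input)

lemma input_n: "input m \<Longrightarrow> agree A m m' \<Longrightarrow> m' 0 = int n"
  by (simp add: input_def agree_input)

lemma input_edge: "input m \<Longrightarrow> u < n \<Longrightarrow> v < n \<Longrightarrow> m (1 + (int u * int n + int v)) = of_bool ({u, v} \<in> E)"
  by (simp add: input_def)

lemma input_edge_index:
  assumes "input m" "e < n * n"
  shows "m (1 + int e) = of_bool ({e div n, e mod n} \<in> E)"
proof -
  have "e div n < n" "e mod n < n" using assms(2) by (auto simp: less_mult_imp_div_less intro!: mod_less_divisor gr0I)
  moreover have "int (e div n) * int n + int (e mod n) = int e"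
    by (metis div_mult_mod_eq of_nat_add of_nat_mult)
  ultimately show ?thesis using input_edge[OF assms(1)] by metis
qed

lemma power_le_B: "k \<le> 2 * n + 3 \<Longrightarrow> 2 ^ k \<le> B"
  unfolding B_def by (intro power_increasing) auto

lemma B_bounds: "int n \<le> B" "int (n * n) \<le> B" "8 \<le> B" "int n + 1 \<le> B"
proof -
  have n: "int n + 1 \<le> 2 ^ n" using less_exp[of n]
    by (metis Suc_leI of_nat_Suc of_nat_le_iff of_nat_numeral of_nat_power add.commute)
  have "int n * int n \<le> 2 ^ n * 2 ^ n" using n by (intro mult_mono) auto
  also have "\<dots> = 2 ^ (2 * n)" by (simp add: power_add mult_2)
  also have "\<dots> \<le> B" by (rule power_le_B) simp
  finally show "int (n * n) \<le> B" by simp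
  show "int n \<le> B" "int n + 1 \<le> B" using n power_le_B[of n] by auto
  show "8 \<le> B" using power_le_B[of 3] by simp
qed

lemma run_clear_marks:
  assumes "input m"
  shows "run B clear_marks m ((n + 1) * 4) (\<lambda>m'. stores_set 18 n {} m' \<and> agree {5, 18} m m')"
proof -
  have "run B clear_marks m ((n + 1) * (1 + 3)) (\<lambda>m'. stores_set 18 n {} m' \<and> agree (insert 5 {18}) m m')"
    unfolding clear_marks_def
  proof (rule run_For[where I = "\<lambda>k. stores_set 18 k {}"])
    fix k m' assume *: "k < n" "stores_set 18 k {} m'" "agree (insert 5 {18}) m m'" "m' (addr 5 0) = int k"
    have "m' 0 = int n" using input_n[OF assms *(3)] .
    then have "wp B (Set_arr 18 (Var 5) (Const 0)) (stores_set 18 (Suc k) {}) m'"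
      using * B_bounds by simp
    from run_wp[OF this] show "run B (Set_arr 18 (Var 5) (Const 0)) m' 1 (stores_set 18 (Suc k) {})" by simp
  next
    fix m' assume "agree (insert 5 {18}) m m'"
    then show "val size_n m' = int n" using input_n[OF assms] by simp
  qed (use B_bounds in auto)
  then show ?thesis by simp
qed

lemma run_branch_loop:
  assumes m: "input m" "stores_set 18 n {} m" "m (addr 3 0) = int j" and j: "int j \<le> B"
  shows "run B (For 4 (size_n \<otimes> size_n) branch_step) m ((n * n + 1) * 20)
    (\<lambda>m'. m' (addr 3 0) = int (guided_rest n E j) \<and>
      stores_set 18 n (guided_cover n E j) m' \<and> agree {3, 4, 5, 6, 18} m m')"
proof -
  let ?I = "\<lambda>e m'. m' (addr 3 0) = int (fst (guided n E j e)) \<and>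
    stores_set 18 n (snd (guided n E j e)) m'"
  have "run B (For 4 (size_n \<otimes> size_n) branch_step) m ((n * n + 1) * (prog_size branch_step + 3))
    (\<lambda>m'. ?I (n * n) m' \<and> agree (insert 4 {3, 5, 6, 18}) m m')"
  proof (rule run_For[where I = ?I])
    fix m' assume "agree (insert 4 {3, 5, 6, 18}) m m'"
    then show "val (size_n \<otimes> size_n) m' = int (n * n)" using input_n[OF m(1)] by simp
  next
    fix e m' assume e: "e < n * n" and I: "?I e m'" and a: "agree (insert 4 {3, 5, 6, 18}) m m'"
      and e': "m' (addr 4 0) = int e"
    obtain x S where eq: "guided n E j e = (x, S)" by fastforce
    define u v where uv: "u = e div n" "v = e mod n"
    have uvn: "u < n" "v < n"
      using e by (auto simp: uv less_mult_imp_div_less intro!: mod_less_divisor gr0I)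
    have iu: "int e div int n = int u" by (simp add: uv zdiv_int)
    have iv: "int e - int n * int u = int v"
      by (simp add: uv zmod_int zdiv_int minus_mult_div_eq_mod)
    have inp: "m' 0 = int n" "m' (1 + int e) = of_bool ({u, v} \<in> E)"
      using input_n[OF m(1) a] input_edge_index[OF input_agree[OF m(1) a] e] uv by auto
    have S: "m' (addr 18 (int u)) = of_bool (u \<in> S)" "m' (addr 18 (int v)) = of_bool (v \<in> S)"
      using I eq uvn by (auto simp: stores_setD)
    have x: "m' (addr 3 0) = int x" using I eq by simp
    have "x \<le> j" using fst_guided[of e n E j] e eq by (simp add: div_le_dividend)
    then have xB: "int x \<le> B" using j by simp
    have cond: "(0 < (int v - int u) * (1 - of_bool a) * (1 - of_bool b) * (1 - of_bool c)) \<longleftrightarrow>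
      u < v \<and> \<not> a \<and> \<not> b \<and> \<not> c" for a b c by auto
    have par: "(2 * int (x div 2) < int x) \<longleftrightarrow> odd x"
      by presburger
    have half: "int x div 2 = int (x div 2)" "int (x div 2) \<le> B" using xB by (auto simp: zdiv_int)
    have st: "stores_set 18 n S m'" using I eq by simp
    have Suc: "guided n E j (Suc e) = (if u < v \<and> {u, v} \<notin> E \<and> u \<notin> S \<and> v \<notin> S
       then (x div 2, insert (if odd x then u else v) S) else (x, S))"
      by (simp add: eq uv)
    have "wp B branch_step (?I (Suc e)) m'"
      unfolding branch_step_def Suc
      using uvn B_bounds xB half st
      by (simp add: e' inp iu iv S x cond par stores_set_insert)
    then show "run B branch_step m' (prog_size branch_step) (?I (Suc e))" by (rule run_wp)
  qed (use m j B_bounds in \<open>auto simp: branch_step_def\<close>)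
  then show ?thesis
    by (rule run_weaken) (auto simp: guided_rest_def guided_cover_def branch_step_def insert_commute)
qed

lemma run_cover_phase:
  defines "J \<equiv> LEAST j. 0 < guided_rest n E j"
  assumes m: "input m" "m (addr 2 0) = 0" "m (addr 3 0) = 0" and J: "int J \<le> B"
  shows "run B cover_phase m ((J + 1) * (32 * (n + 1)\<^sup>2))
    (\<lambda>m'. stores_set 18 n (guided_cover n E J) m' \<and> agree {2, 3, 4, 5, 6, 18} m m')"
proof -
  have ex: "0 < guided_rest n E J" unfolding J_def
    by (rule LeastI_ex) (use guide_exists_vertex_cover_number[of n E] in blast)
  have rest0: "guided_rest n E k = 0" if "k < J" for k
    using that not_less_Least unfolding J_def by blast
  \<comment> \<open>Guide 0 leaves rest 0, so at least one scan takes place.\<close>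
  have J0: "0 < J"
  proof (rule ccontr)
    assume "\<not> 0 < J"
    then show False using ex fst_guided[of "n * n" n E 0] by (simp add: guided_rest_def)
  qed
  let ?A = "{2, 3, 4, 5, 6, 18}"
  \<comment> \<open>For \<open>k = 0\<close> nothing has been scanned yet, but the rest of guide 0
    agrees with the initial content 0 of its cell.\<close>
  let ?I = "\<lambda>k m'. m' (addr 2 0) = int k \<and> m' (addr 3 0) = int (guided_rest n E k) \<and>
    (0 < k \<longrightarrow> stores_set 18 n (guided_cover n E k) m')"
  let ?s = "2 + ((n + 1) * 4 + (n * n + 1) * 20)"
  have "run B cover_phase m ((J + 1) * (?s + 1)) (\<lambda>m'. ?I J m' \<and> agree ?A m m')"
    unfolding cover_phase_def
  proof (rule run_While[where I = ?I])
    show "?I 0 m" using m rest0[OF J0] by simp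
    show "writes ?A ((Set_var 2 (Var 2 \<oplus> Const 1);; Set_var 3 (Var 2));; clear_marks;;
        For 4 (size_n \<otimes> size_n) branch_step)"
      by (simp add: clear_marks_def branch_step_def)
  next
    fix k m0 assume k: "k < J" and I: "?I k m0" and a: "agree ?A m m0"
    have kB: "int k + 1 \<le> B" using k J by linarith
    have in0: "input m0" using input_agree[OF m(1) a] .
    let ?Q1 = "\<lambda>m'. m' (addr 2 0) = int (Suc k) \<and> m' (addr 3 0) = int (Suc k)"
    let ?P1 = "Set_var 2 (Var 2 \<oplus> Const 1);; Set_var 3 (Var 2)"
    have "wp B ?P1 ?Q1 m0" using I kB by simp
    then have 1: "run B ?P1 m0 2 (\<lambda>m'. ?Q1 m' \<and> agree {2, 3} m0 m')"
      by (rule run_wp_agree) simp_all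
    have "run B (?P1;; clear_marks;; For 4 (size_n \<otimes> size_n) branch_step) m0 ?s (?I (Suc k))"
    proof (rule run_Seq[OF 1], rule run_Seq)
      fix m1 assume m1: "?Q1 m1 \<and> agree {2, 3} m0 m1"
      have in1: "input m1" using input_agree[OF in0, of "{2, 3}" m1] m1 by blast
      show "run B clear_marks m1 ((n + 1) * 4) (\<lambda>m'. stores_set 18 n {} m' \<and> agree {5, 18} m1 m')"
        by (rule run_clear_marks[OF in1])
      fix m2 assume m2: "stores_set 18 n {} m2 \<and> agree {5, 18} m1 m2"
      then have a12: "agree {5, 18} m1 m2" by blast
      have v: "m2 (addr 2 0) = int (Suc k)" "m2 (addr 3 0) = int (Suc k)"
        using agree_addr[OF a12] m1 by simp_all
      have "run B (For 4 (size_n \<otimes> size_n) branch_step) m2 ((n * n + 1) * 20)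
         (\<lambda>m'. m' (addr 3 0) = int (guided_rest n E (Suc k)) \<and>
            stores_set 18 n (guided_cover n E (Suc k)) m' \<and> agree {3, 4, 5, 6, 18} m2 m')"
        using m2 v kB by (intro run_branch_loop input_agree[OF in1 a12]) auto
      then show "run B (For 4 (size_n \<otimes> size_n) branch_step) m2 ((n * n + 1) * 20) (?I (Suc k))"
        by (rule run_weaken) (use v(1) in \<open>auto simp: agree_addr\<close>)
    qed
    then show "0 < val (Const 1 \<ominus> Var 3) m0 \<and>
        run B (?P1;; clear_marks;; For 4 (size_n \<otimes> size_n) branch_step) m0 ?s (?I (Suc k))"
      using I rest0[OF k] by simp
  next
    fix m' assume "?I J m'"
    then show "\<not> 0 < val (Const 1 \<ominus> Var 3) m'" using ex by simp
  qed
  then show ?thesis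
  proof (rule run_weaken)
    have "?s + 1 \<le> 32 * (n + 1)\<^sup>2" by (simp add: power2_eq_square)
    then show "(J + 1) * (?s + 1) \<le> (J + 1) * (32 * (n + 1)\<^sup>2)" by (rule mult_le_mono2)
  qed (use J0 in auto)
qed

end

section \<open>Correctness and running time of the tables over a cover\<close>

locale graph_cover = graph_memory +
  fixes C :: "nat set"
  assumes C: "C \<subseteq> {..<n}"
begin

lemma finite_C: "finite C"
  using C finite_subset by blast

lemma card_C: "card C \<le> n"
  using card_mono[OF _ C] by simp

lemma decode_less: "decode C x \<subseteq> {..<n}"
  using decode_subset C by blast

lemma finite_decode: "finite (decode C x)"
  using decode_less finite_subset by blast

lemma finite_nbhd: "finite (nbhd E (decode C x))"
  using nbhd_subset[OF G decode_less] finite_subset by blast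

lemma card_decode: "card (decode C x) \<le> n"
  using card_mono[OF _ decode_less, of x] by simp

lemma power_rank_le_B: "2 ^ rank C u \<le> B"
  using rank_le_card[OF finite_C, of u] card_C by (intro power_le_B) linarith

lemma code_le_B: "M \<subseteq> C \<Longrightarrow> int (code C M) \<le> B"
proof -
  assume "M \<subseteq> C"
  then have "code C M < 2 ^ card C" by (rule code_less[OF finite_C])
  then have "int (code C M) < 2 ^ card C" by (metis of_nat_less_iff of_nat_numeral of_nat_power)
  also have "\<dots> \<le> B" using card_C by (intro power_le_B) linarith
  finally show ?thesis by simp
qed

lemma run_count_phase:
  assumes m: "input m" "stores_set 18 n C m"
  shows "run B count_phase m ((n + 1) * 8) (\<lambda>m'. m' (addr 7 0) = 2 ^ card C \<and> agree {5, 7} m m')"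
proof -
  have "wp B (Set_var 7 (Const 1)) (\<lambda>m'. m' (addr 7 0) = 1) m" using B_bounds by simp
  then have 1: "run B (Set_var 7 (Const 1)) m 1 (\<lambda>m'. m' (addr 7 0) = 1 \<and> agree {7} m m')"
    by (rule run_wp_agree) simp_all
  let ?P = "If_pos (Arr 18 (Var 5)) (Set_var 7 (Const 2 \<otimes> Var 7)) Skip"
  let ?I = "\<lambda>u m'. m' (addr 7 0) = 2 ^ rank C u"
  have "run B count_phase m (1 + (n + 1) * (prog_size ?P + 3))
    (\<lambda>m'. m' (addr 7 0) = 2 ^ card C \<and> agree {5, 7} m m')"
    unfolding count_phase_def
  proof (rule run_Seq[OF 1])
    fix m1 assume m1: "m1 (addr 7 0) = 1 \<and> agree {7} m m1"
    then have a1: "agree {7} m m1" by blast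
    have "run B (For 5 size_n ?P) m1 ((n + 1) * (prog_size ?P + 3))
        (\<lambda>m'. ?I n m' \<and> agree (insert 5 {7}) m1 m')"
    proof (rule run_For[where I = ?I])
      fix m' assume "agree (insert 5 {7}) m1 m'"
      then show "val size_n m' = int n" using input_n[OF input_agree[OF m(1) a1]] by simp
    next
      fix u m' assume u: "u < n" "m' (addr 7 0) = 2 ^ rank C u" "agree (insert 5 {7}) m1 m'"
        "m' (addr 5 0) = int u"
      have "stores_set 18 n C m'"
        using stores_set_agree[OF stores_set_agree[OF m(2) a1] u(3)] by simp
      then have "m' (addr 18 (int u)) = of_bool (u \<in> C)" using u(1) by (rule stores_setD)
      then have "wp B ?P (?I (Suc u)) m'"
        using u power_rank_le_B[of "Suc u"] by (simp add: rank_Suc split: if_splits)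
      then show "run B ?P m' (prog_size ?P) (?I (Suc u))" by (rule run_wp)
    qed (use m1 B_bounds in auto)
    then show "run B (For 5 size_n ?P) m1 ((n + 1) * (prog_size ?P + 3))
        (\<lambda>m'. m' (addr 7 0) = 2 ^ card C \<and> agree {5, 7} m m')"
      by (rule run_weaken)
        (use rank_eq_card[OF C] agree_trans[OF agree_mono[OF a1]] in auto)
  qed
  then show ?thesis by (rule run_weaken) (auto simp: algebra_simps)
qed

text \<open>Removing a vertex lowers the code, so the table entries below \<open>x\<close>
  suffice.\<close>

lemma run_decode_loop:
  fixes x w
  defines "D \<equiv> decode C x"
  assumes m: "input m" "stores_set 18 n C m" "m (addr 10 0) = int x"
    "stores 20 x (\<lambda>y. int (best E w (decode C y))) m" and x: "x < 2 ^ card C"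
  shows "run B decode_loop m ((n + 1) * 24) (\<lambda>m'. stores_set 19 n D m' \<and>
    m' (addr 13 0) = int (card D) \<and> m' (addr 14 0) = int (best_remove E w D D) \<and>
    agree {5, 11, 12, 13, 14, 19} m m')"
proof -
  have xB: "int x \<le> B"
  proof -
    have "int x < 2 ^ card C" using x by (metis of_nat_less_iff of_nat_numeral of_nat_power)
    also have "\<dots> \<le> B" using card_C by (intro power_le_B) linarith
    finally show ?thesis by simp
  qed
  let ?P = "Set_var 11 (Var 10);; Set_var 12 (Const 1);; Set_var 13 (Const 0);; Set_var 14 (Const 0)"
  let ?Q = "\<lambda>m'. m' (addr 11 0) = int x \<and> m' (addr 12 0) = 1 \<and> m' (addr 13 0) = 0 \<and> m' (addr 14 0) = 0"
  have "wp B ?P ?Q m" using B_bounds xB m(3) by simp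
  then have 1: "run B ?P m 4 (\<lambda>m'. ?Q m' \<and> agree {11, 12, 13, 14} m m')"
    by (rule run_wp_agree) simp_all
  let ?I = "\<lambda>u m'. m' (addr 11 0) = int (x div 2 ^ rank C u) \<and> m' (addr 12 0) = 2 ^ rank C u \<and>
    m' (addr 13 0) = int (card (D \<inter> {..<u})) \<and> m' (addr 14 0) = int (best_remove E w D (D \<inter> {..<u})) \<and>
    stores_set 19 u D m'"
  let ?A = "{11, 12, 13, 14, 19}"
  have D: "finite D" "D \<subseteq> {..<n}" "D \<subseteq> C"
    unfolding D_def by (rule finite_decode decode_less decode_subset)+
  have "run B decode_loop m (4 + (n + 1) * (prog_size decode_step + 3)) (\<lambda>m'. stores_set 19 n D m' \<and>
    m' (addr 13 0) = int (card D) \<and> m' (addr 14 0) = int (best_remove E w D D) \<and>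
    agree {5, 11, 12, 13, 14, 19} m m')"
    unfolding decode_loop_def
  proof (rule run_Seq[OF 1])
    fix m1 assume m1: "?Q m1 \<and> agree {11, 12, 13, 14} m m1"
    then have a1: "agree {11, 12, 13, 14} m m1" by blast
    have in1: "input m1" using input_agree[OF m(1) a1] .
    have "run B (For 5 size_n decode_step) m1 ((n + 1) * (prog_size decode_step + 3))
        (\<lambda>m'. ?I n m' \<and> agree (insert 5 ?A) m1 m')"
    proof (rule run_For[where I = ?I])
      fix m' assume "agree (insert 5 ?A) m1 m'"
      then show "val size_n m' = int n" using input_n[OF in1] by simp
    next
      fix u m' assume u: "u < n" and I: "?I u m'" and a: "agree (insert 5 ?A) m1 m'"
        and u': "m' (addr 5 0) = int u"
      let ?r = "rank C u" and ?b = "best E w (D - {u})" and ?mx = "best_remove E w D (D \<inter> {..<u})"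
      have "stores_set 18 n C m'"
        using stores_set_agree[OF stores_set_agree[OF m(2) a1] a] by simp
      then have mk: "m' (addr 18 (int u)) = of_bool (u \<in> C)" using u by (rule stores_setD)
      have tab: "stores 20 x (\<lambda>y. int (best E w (decode C y))) m'"
        using stores_agree[OF stores_agree[OF m(4) a1] a] by simp
      have m10: "m' (addr 10 0) = int x" using agree_addr[OF a1] agree_addr[OF a] m(3) by simp
      \<comment> \<open>After \<open>rank C u\<close> halvings the lowest bit of the code tells
        whether \<open>u\<close> belongs to \<open>D\<close>.\<close>
      have par: "2 * int (x div 2 ^ ?r div 2) < int (x div 2 ^ ?r) \<longleftrightarrow> u \<in> D" if "u \<in> C"
        using that by (simp add: D_def decode_def bit_iff_odd half_less_iff_odd)
      have half: "int (x div 2 ^ ?r) div 2 = int (x div 2 ^ ?r div 2)"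
        by (simp add: zdiv_int)
      have halfB: "int (x div 2 ^ ?r div 2) \<le> B"
        using xB by (meson div_le_dividend le_trans of_nat_le_iff order_trans)
      have shift: "x div 2 ^ ?r div 2 = x div 2 ^ rank C (Suc u)" if "u \<in> C"
        using that by (simp add: rank_Suc div_mult2_eq[symmetric] mult.commute)
      have idx: "m' (addr 20 (int x - 2 ^ ?r)) = int ?b" if "u \<in> D"
      proof -
        have le: "2 ^ ?r \<le> x" using that unfolding D_def by (rule power_rank_le)
        then have "int x - 2 ^ ?r = int (x - 2 ^ ?r)" by (simp add: of_nat_diff)
        moreover have "x - 2 ^ ?r < x" using le by (simp add: less_le_trans[of 0 "2 ^ ?r" x])
        moreover have "decode C (x - 2 ^ ?r) = D - {u}"
          using that decode_remove unfolding D_def by blast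
        ultimately show ?thesis using storesD[OF tab] by metis
      qed
      have cut: "D \<inter> {..<Suc u} = (if u \<in> D then insert u (D \<inter> {..<u}) else D \<inter> {..<u})"
        by (auto simp: less_Suc_eq)
      have "card (D \<inter> {..<u}) \<le> card {..<u}" by (intro card_mono) auto
      then have cB: "int (card (D \<inter> {..<u})) + 1 \<le> B" using u B_bounds by simp
      have "?b \<le> card D" using best_le_card[of "D - {u}" E w] D card_mono[of D "D - {u}"] by simp
      then have bB: "int ?b \<le> B" using card_decode[of x] B_bounds by (simp add: D_def)
      have pB: "2 * 2 ^ ?r \<le> B" if "u \<in> C" using that power_rank_le_B[of "Suc u"] by (simp add: rank_Suc)
      have CD: "u \<in> D \<Longrightarrow> u \<in> C" using D by blast
      have "wp B decode_step (?I (Suc u)) m'"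
      proof (cases "u \<in> C")
        case False
        then show ?thesis unfolding decode_step_def cut
          using I CD B_bounds by (auto simp: mk u' rank_Suc)
      next
        case uC: True
        show ?thesis
        proof (cases "u \<in> D")
          case False
          then show ?thesis unfolding decode_step_def cut
            using I B_bounds uC par[OF uC] halfB pB[OF uC] shift[OF uC]
            by (simp add: mk u' half rank_Suc)
        next
          case True
          then show ?thesis unfolding decode_step_def cut
            using I B_bounds uC par[OF uC] halfB pB[OF uC] shift[OF uC] idx[OF True] cB bB D(1)
            by (simp add: mk u' m10 half rank_Suc best_remove_insert)
        qed
      qed
      then show "run B decode_step m' (prog_size decode_step) (?I (Suc u))" by (rule run_wp)
    qed (use m1 B_bounds in \<open>auto simp: decode_step_def\<close>)
    then show "run B (For 5 size_n decode_step) m1 ((n + 1) * (prog_size decode_step + 3))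
        (\<lambda>m'. stores_set 19 n D m' \<and> m' (addr 13 0) = int (card D) \<and>
          m' (addr 14 0) = int (best_remove E w D D) \<and> agree {5, 11, 12, 13, 14, 19} m m')"
    proof (rule run_weaken)
      have "D \<inter> {..<n} = D" using D by auto
      then show "stores_set 19 n D m' \<and> m' (addr 13 0) = int (card D) \<and>
          m' (addr 14 0) = int (best_remove E w D D) \<and> agree {5, 11, 12, 13, 14, 19} m m'"
        if "?I n m' \<and> agree (insert 5 ?A) m1 m'" for m'
        using that agree_trans[OF agree_mono[OF a1]] by auto
    qed simp
  qed
  then show ?thesis by (rule run_weaken) (auto simp: decode_step_def algebra_simps)
qed


text \<open>The inner scan raises the flag when it meets a neighbour of \<open>u\<close> in
  \<open>D\<close>. The weight then advances at every vertex of \<open>C\<close>, whether or not its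
  bit was added to the code.\<close>

lemma run_nbhd_step:
  fixes D :: "nat set"
  defines "NB \<equiv> nbhd E D"
  assumes D: "D \<subseteq> {..<n}"
    and m: "input m" "stores_set 18 n C m" "stores_set 19 n D m" "m (addr 5 0) = int u" and u: "u < n"
    and I: "m (addr 12 0) = 2 ^ rank C u" "m (addr 15 0) = int (card (NB \<inter> {..<u}))"
      "m (addr 16 0) = int (code C ((C - NB) \<inter> {..<u}))"
  shows "run B nbhd_step m ((n + 1) * 13) (\<lambda>m'. m' (addr 12 0) = 2 ^ rank C (Suc u) \<and>
    m' (addr 15 0) = int (card (NB \<inter> {..<Suc u})) \<and>
    m' (addr 16 0) = int (code C ((C - NB) \<inter> {..<Suc u})))"
proof -
  have "wp B (Set_var 17 (Arr 19 (Var 5))) (\<lambda>m'. m' (addr 17 0) = of_bool (u \<in> D)) m"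
    using stores_setD[OF m(3) u] B_bounds by (simp add: m(4))
  then have 1: "run B (Set_var 17 (Arr 19 (Var 5))) m 1
      (\<lambda>m'. m' (addr 17 0) = of_bool (u \<in> D) \<and> agree {17} m m')"
    by (rule run_wp_agree) simp_all
  let ?P = "If_pos (Arr 19 (Var 6) \<otimes> Cell (Const 1 \<oplus> (Var 5 \<otimes> size_n \<oplus> Var 6))) (Set_var 17 (Const 1)) Skip"
  let ?J = "\<lambda>v m'. m' (addr 17 0) = of_bool (u \<in> D \<or> (\<exists>a<v. a \<in> D \<and> {u, a} \<in> E))"
  let ?R = "Set_var 15 (Var 15 \<oplus> Var 17);;
     If_pos (Arr 18 (Var 5))
       (Set_var 16 (Var 16 \<oplus> Var 12 \<otimes> (Const 1 \<ominus> Var 17));; Set_var 12 (Const 2 \<otimes> Var 12))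
       Skip"
  let ?Q = "\<lambda>m'. m' (addr 12 0) = 2 ^ rank C (Suc u) \<and>
    m' (addr 15 0) = int (card (NB \<inter> {..<Suc u})) \<and>
    m' (addr 16 0) = int (code C ((C - NB) \<inter> {..<Suc u}))"
  have "run B nbhd_step m (1 + ((n + 1) * (prog_size ?P + 3) + prog_size ?R)) ?Q"
    unfolding nbhd_step_def
  proof (rule run_Seq[OF 1], rule run_Seq)
    fix m1 assume m1: "m1 (addr 17 0) = of_bool (u \<in> D) \<and> agree {17} m m1"
    then have a1: "agree {17} m m1" by blast
    show "run B (For 6 size_n ?P) m1 ((n + 1) * (prog_size ?P + 3))
        (\<lambda>m'. ?J n m' \<and> agree (insert 6 {17}) m1 m')"
    proof (rule run_For[where I = ?J])
      fix m' assume "agree (insert 6 {17}) m1 m'"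
      then show "val size_n m' = int n" using input_n[OF input_agree[OF m(1) a1]] by simp
    next
      fix v m' assume v: "v < n" and J: "?J v m'" and a: "agree (insert 6 {17}) m1 m'"
        and v': "m' (addr 6 0) = int v"
      have u': "m' (addr 5 0) = int u" using agree_addr[OF a1] agree_addr[OF a] m(4) by simp
      have inp: "input m'" using input_agree[OF input_agree[OF m(1) a1] a] .
      have ed: "m' (1 + (int u * int n + int v)) = of_bool ({u, v} \<in> E)"
        using input_edge[OF inp u v] .
      have n': "m' 0 = int n" using input_n[OF inp agree_refl] .
      have "stores_set 19 n D m'"
        using stores_set_agree[OF stores_set_agree[OF m(3) a1] a] by simp
      then have dv: "m' (addr 19 (int v)) = of_bool (v \<in> D)" using v by (rule stores_setD)
      have "wp B ?P (?J (Suc v)) m'"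
        using J B_bounds by (auto simp: v' u' ed n' dv less_Suc_eq)
      then show "run B ?P m' (prog_size ?P) (?J (Suc v))" by (rule run_wp)
    qed (use m1 B_bounds in auto)
    fix m2 assume m2: "?J n m2 \<and> agree (insert 6 {17}) m1 m2"
    then have a2: "agree (insert 6 {17}) m1 m2" by blast
    have "stores_set 18 n C m2"
      using stores_set_agree[OF stores_set_agree[OF m(2) a1] a2] by simp
    then have mk: "m2 (addr 18 (int u)) = of_bool (u \<in> C)" using u by (rule stores_setD)
    have v: "m2 (addr 5 0) = int u" "m2 (addr 12 0) = 2 ^ rank C u"
      "m2 (addr 15 0) = int (card (NB \<inter> {..<u}))" "m2 (addr 16 0) = int (code C ((C - NB) \<inter> {..<u}))"
      using agree_addr[OF a1] agree_addr[OF a2] m(4) I by simp_all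
    have "(\<exists>a<n. a \<in> D \<and> {u, a} \<in> E) \<longleftrightarrow> (\<exists>a\<in>D. {u, a} \<in> E)" using D by auto
    then have nb: "m2 (addr 17 0) = of_bool (u \<in> NB)" using m2 by (simp add: NB_def nbhd_def)
    have cutN: "NB \<inter> {..<Suc u} = (if u \<in> NB then insert u (NB \<inter> {..<u}) else NB \<inter> {..<u})"
      by (auto simp: less_Suc_eq)
    have cutC: "(C - NB) \<inter> {..<Suc u} = (if u \<in> C \<and> u \<notin> NB then insert u ((C - NB) \<inter> {..<u})
        else (C - NB) \<inter> {..<u})"
      by (auto simp: less_Suc_eq)
    have code: "code C (insert u ((C - NB) \<inter> {..<u})) = 2 ^ rank C u + code C ((C - NB) \<inter> {..<u})"
      using finite_C by (simp add: code_def)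
    have "card (NB \<inter> {..<u}) \<le> card {..<u}" by (intro card_mono) auto
    then have cB: "int (card (NB \<inter> {..<u})) + 1 \<le> B" using u B_bounds by simp
    have pB: "2 * 2 ^ rank C u \<le> B" if "u \<in> C" using that power_rank_le_B[of "Suc u"] by (simp add: rank_Suc)
    have rB: "int (code C ((C - NB) \<inter> {..<u})) \<le> B" "int (code C ((C - NB) \<inter> {..<Suc u})) \<le> B"
      by (rule code_le_B; blast)+
    have rB': "2 ^ rank C u + int (code C ((C - NB) \<inter> {..<u})) \<le> B" if "u \<in> C" "u \<notin> NB"
      using rB(2) that cutC code by simp
    have "wp B ?R ?Q m2"
    proof (cases "u \<in> C")
      case False
      then show ?thesis using cB B_bounds cutN cutC by (simp add: v mk nb rank_Suc)
    next
      case True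
      then show ?thesis using cB B_bounds cutN cutC code pB rB rB' by (simp add: v mk nb rank_Suc add.commute)
    qed
    then show "run B ?R m2 (prog_size ?R) ?Q" by (rule run_wp)
  qed
  then show ?thesis by (rule run_weaken) auto
qed

lemma run_nbhd_loop:
  fixes D :: "nat set"
  defines "NB \<equiv> nbhd E D"
  assumes D: "D \<subseteq> {..<n}" and m: "input m" "stores_set 18 n C m" "stores_set 19 n D m"
  shows "run B nbhd_loop m (20 * (n + 1)\<^sup>2) (\<lambda>m'. m' (addr 15 0) = int (card NB) \<and>
    m' (addr 16 0) = int (code C (C - NB)) \<and> agree {5, 6, 12, 15, 16, 17} m m')"
proof -
  let ?P = "Set_var 12 (Const 1);; Set_var 15 (Const 0);; Set_var 16 (Const 0)"
  let ?Q = "\<lambda>m'. m' (addr 12 0) = 1 \<and> m' (addr 15 0) = 0 \<and> m' (addr 16 0) = 0"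
  have "wp B ?P ?Q m" using B_bounds by simp
  then have 1: "run B ?P m 3 (\<lambda>m'. ?Q m' \<and> agree {12, 15, 16} m m')"
    by (rule run_wp_agree) simp_all
  let ?A = "{6, 12, 15, 16, 17}"
  let ?I = "\<lambda>u m'. m' (addr 12 0) = 2 ^ rank C u \<and> m' (addr 15 0) = int (card (NB \<inter> {..<u})) \<and>
    m' (addr 16 0) = int (code C ((C - NB) \<inter> {..<u}))"
  have "run B nbhd_loop m (3 + (n + 1) * ((n + 1) * 13 + 3)) (\<lambda>m'. m' (addr 15 0) = int (card NB) \<and>
    m' (addr 16 0) = int (code C (C - NB)) \<and> agree {5, 6, 12, 15, 16, 17} m m')"
    unfolding nbhd_loop_def
  proof (rule run_Seq[OF 1])
    fix m1 assume m1: "?Q m1 \<and> agree {12, 15, 16} m m1"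
    then have a1: "agree {12, 15, 16} m m1" by blast
    have in1: "input m1" using input_agree[OF m(1) a1] .
    have "run B (For 5 size_n nbhd_step) m1 ((n + 1) * ((n + 1) * 13 + 3))
        (\<lambda>m'. ?I n m' \<and> agree (insert 5 ?A) m1 m')"
    proof (rule run_For[where I = ?I])
      fix m' assume "agree (insert 5 ?A) m1 m'"
      then show "val size_n m' = int n" using input_n[OF in1] by simp
    next
      fix u m' assume u: "u < n" "?I u m'" "agree (insert 5 ?A) m1 m'" "m' (addr 5 0) = int u"
      have "stores_set 18 n C m'" "stores_set 19 n D m'"
        using stores_set_agree[OF stores_set_agree[OF m(2) a1] u(3)]
          stores_set_agree[OF stores_set_agree[OF m(3) a1] u(3)] by simp_all
      then show "run B nbhd_step m' ((n + 1) * 13) (?I (Suc u))"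
        unfolding NB_def
        by (intro run_nbhd_step D input_agree[OF in1 u(3)] u(1) u(4)) (use u(2) in \<open>auto simp: NB_def\<close>)
    qed (use m1 B_bounds in \<open>auto simp: nbhd_step_def code_def\<close>)
    then show "run B (For 5 size_n nbhd_step) m1 ((n + 1) * ((n + 1) * 13 + 3))
        (\<lambda>m'. m' (addr 15 0) = int (card NB) \<and> m' (addr 16 0) = int (code C (C - NB)) \<and>
          agree {5, 6, 12, 15, 16, 17} m m')"
    proof (rule run_weaken)
      have "NB \<inter> {..<n} = NB" "(C - NB) \<inter> {..<n} = C - NB"
        using nbhd_subset[OF G D] C unfolding NB_def by auto
      then show "m' (addr 15 0) = int (card NB) \<and> m' (addr 16 0) = int (code C (C - NB)) \<and>
          agree {5, 6, 12, 15, 16, 17} m m'" if "?I n m' \<and> agree (insert 5 ?A) m1 m'" for m'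
        using that agree_trans[OF agree_mono[OF a1]] by auto
    qed simp
  qed
  then show ?thesis by (rule run_weaken) (auto simp: algebra_simps power2_eq_square)
qed

definition tables :: "nat \<Rightarrow> nat \<Rightarrow> memory \<Rightarrow> bool" where
  "tables w x m \<longleftrightarrow> stores 20 x (\<lambda>y. int (best E w (decode C y))) m \<and>
    stores 21 x (\<lambda>y. int (card (decode C y))) m \<and>
    stores 22 x (\<lambda>y. int (code C (C - nbhd E (decode C y)))) m"

lemma run_table_step:
  assumes m: "input m" "stores_set 18 n C m" "m (addr 10 0) = int x" "m (addr 8 0) = int w"
    "tables w x m" and x: "x < 2 ^ card C"
  shows "run B table_step m (60 * (n + 1)\<^sup>2) (tables w (Suc x))"
proof -
  let ?D = "decode C x"
  let ?NB = "nbhd E ?D"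
  let ?R = "If_pos (Var 14 \<ominus> Var 13 \<oplus> Const 2)
      (If_pos (Var 8 \<oplus> Var 13 \<ominus> Var 15) (Set_arr 20 (Var 10) (Var 13)) (Set_arr 20 (Var 10) (Var 14)))
      (Set_arr 20 (Var 10) (Var 14));;
     Set_arr 21 (Var 10) (Var 13);; Set_arr 22 (Var 10) (Var 16)"
  have "run B table_step m ((n + 1) * 24 + (20 * (n + 1)\<^sup>2 + prog_size ?R)) (tables w (Suc x))"
    unfolding table_step_def
  proof (rule run_Seq[OF run_decode_loop[OF m(1-3) _ x, of w]], goal_cases)
    case 1
    then show ?case using m(5) by (simp add: tables_def)
  next
    case (2 m1)
    then have a1: "agree {5, 11, 12, 13, 14, 19} m m1" by blast
    have in1: "input m1" using input_agree[OF m(1) a1] .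
    have mk1: "stores_set 18 n C m1" using stores_set_agree[OF m(2) a1] by simp
    from 2 have d1: "stores_set 19 n ?D m1" by blast
    show ?case
    proof (rule run_Seq[OF run_nbhd_loop[OF decode_less in1 mk1 d1]])
      fix m2 assume m2: "m2 (addr 15 0) = int (card ?NB) \<and> m2 (addr 16 0) = int (code C (C - ?NB)) \<and>
        agree {5, 6, 12, 15, 16, 17} m1 m2"
      then have a2: "agree {5, 6, 12, 15, 16, 17} m1 m2" by blast
      have v: "m2 (addr 13 0) = int (card ?D)" "m2 (addr 14 0) = int (best_remove E w ?D ?D)"
        "m2 (addr 10 0) = int x" "m2 (addr 8 0) = int w"
        using 2 agree_addr[OF a1] agree_addr[OF a2] m(3,4) by simp_all
      have tab: "stores 20 x (\<lambda>y. int (best E w (decode C y))) m2"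
        "stores 21 x (\<lambda>y. int (card (decode C y))) m2"
        "stores 22 x (\<lambda>y. int (code C (C - nbhd E (decode C y)))) m2"
        using m(5) stores_agree[OF stores_agree[OF _ a1] a2] by (simp_all add: tables_def)
      have dB: "int (card ?D) \<le> B" using card_decode[of x] B_bounds by simp
      have bB: "int (best_remove E w ?D ?D) \<le> B"
        using best_remove_le[OF finite_decode, of ?D x E w] dB by simp
      have cB: "int (code C (C - ?NB)) \<le> B" by (rule code_le_B) auto
      have rec: "best E w ?D = (if card ?D \<le> best_remove E w ?D ?D + 1 \<and> card ?NB < w + card ?D
        then card ?D else best_remove E w ?D ?D)"
        by (rule best_rec[OF finite_decode finite_nbhd])
      \<comment> \<open>The offset 2 turns \<open>card ?D \<le> best_remove E w ?D ?D + 1\<close>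
        into a strict inequality.\<close>
      have cond: "0 < int (best_remove E w ?D ?D) - int (card ?D) + 2 \<longleftrightarrow> card ?D \<le> best_remove E w ?D ?D + 1"
        "0 < int w + int (card ?D) - int (card ?NB) \<longleftrightarrow> card ?NB < w + card ?D" by auto
      have "wp B ?R (tables w (Suc x)) m2"
        using dB bB cB m2 tab unfolding tables_def
        by (simp add: v cond rec del: of_nat_add)
      then show "run B ?R m2 (prog_size ?R) (tables w (Suc x))" by (rule run_wp)
    qed
  qed
  then show ?thesis by (rule run_weaken) (auto simp: power2_eq_square algebra_simps)
qed

lemma run_table_loop:
  assumes m: "input m" "stores_set 18 n C m" "m (addr 7 0) = 2 ^ card C" "m (addr 8 0) = int w"
  shows "run B (For 10 (Var 7) table_step) m ((2 ^ card C + 1) * (60 * (n + 1)\<^sup>2 + 3))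
    (\<lambda>m'. tables w (2 ^ card C) m' \<and>
      agree {5, 6, 10, 11, 12, 13, 14, 15, 16, 17, 19, 20, 21, 22} m m')"
proof -
  let ?A = "{5, 6, 11, 12, 13, 14, 15, 16, 17, 19, 20, 21, 22}"
  have "run B (For 10 (Var 7) table_step) m ((2 ^ card C + 1) * (60 * (n + 1)\<^sup>2 + 3))
    (\<lambda>m'. tables w (2 ^ card C) m' \<and> agree (insert 10 ?A) m m')"
  proof (rule run_For[where I = "tables w"])
    fix m' assume "agree (insert 10 ?A) m m'"
    then show "val (Var 7) m' = int (2 ^ card C)" using m(3) by (simp add: agree_addr)
  next
    fix x m' assume x: "x < 2 ^ card C" "tables w x m'" and a: "agree (insert 10 ?A) m m'"
      and x': "m' (addr 10 0) = int x"
    have "stores_set 18 n C m'" using stores_set_agree[OF m(2) a] by simp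
    moreover have "m' (addr 8 0) = int w" using agree_addr[OF a] m(4) by simp
    ultimately show "run B table_step m' (60 * (n + 1)\<^sup>2) (tables w (Suc x))"
      using x x' by (intro run_table_step input_agree[OF m(1) a]) auto
  next
    show "int (2 ^ card C) \<le> B" using power_le_B[of "card C"] card_C by simp
    show "writes ?A table_step"
      by (simp add: table_step_def decode_loop_def decode_step_def nbhd_loop_def nbhd_step_def)
  qed (auto simp: tables_def)
  then show ?thesis by (simp add: insert_commute)
qed

definition good :: "nat \<Rightarrow> nat \<Rightarrow> bool" where
  "good w x \<longleftrightarrow> best E w (decode C x) = card (decode C x) \<and>
    n \<le> w + card (decode C x) + best E w (C - nbhd E (decode C x))"

lemma feasible_iff_good: "feasible {..<n} E C w \<longleftrightarrow> (\<exists>x<2 ^ card C. good w x)"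
proof
  assume "feasible {..<n} E C w"
  then obtain L where L: "L \<subseteq> C" "best E w L = card L"
    "card {..<n} \<le> w + card L + best E w (C - nbhd E L)"
    unfolding feasible_iff_best[OF finite_C] by blast
  have "decode C (code C L) = L" using L(1) finite_C by (intro decode_code) (auto intro: finite_subset)
  then show "\<exists>x<2 ^ card C. good w x"
    using L code_less[OF finite_C L(1)] unfolding good_def by (intro exI[of _ "code C L"]) simp
next
  assume "\<exists>x<2 ^ card C. good w x"
  then obtain x where "good w x" by blast
  then show "feasible {..<n} E C w"
    unfolding feasible_iff_best[OF finite_C] good_def
    by (intro exI[of _ "decode C x"]) (simp add: decode_subset)
qed

text \<open>The code of \<open>C - N[L]\<close> may exceed that of \<open>L\<close>, so this pass
  follows the filling of the whole table.\<close>

lemma run_check_loop: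
  assumes m: "input m" "m (addr 7 0) = 2 ^ card C" "m (addr 8 0) = int w" "m (addr 9 0) = 0"
    "tables w (2 ^ card C) m"
  shows "run B (For 10 (Var 7) check_step) m ((2 ^ card C + 1) * 10)
    (\<lambda>m'. m' (addr 9 0) = of_bool (feasible {..<n} E C w) \<and> agree {9, 10} m m')"
proof -
  let ?I = "\<lambda>x m'. m' (addr 9 0) = of_bool (\<exists>y<x. good w y)"
  have "run B (For 10 (Var 7) check_step) m ((2 ^ card C + 1) * (prog_size check_step + 3))
    (\<lambda>m'. ?I (2 ^ card C) m' \<and> agree (insert 10 {9}) m m')"
  proof (rule run_For[where I = ?I])
    fix m' assume "agree (insert 10 {9}) m m'"
    then show "val (Var 7) m' = int (2 ^ card C)" using m(2) by (simp add: agree_addr)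
  next
    fix x m' assume x: "x < 2 ^ card C" and I: "?I x m'" and a: "agree (insert 10 {9}) m m'"
      and x': "m' (addr 10 0) = int x"
    let ?D = "decode C x"
    let ?r = "code C (C - nbhd E ?D)"
    have tab: "stores 20 (2 ^ card C) (\<lambda>y. int (best E w (decode C y))) m'"
        "stores 21 (2 ^ card C) (\<lambda>y. int (card (decode C y))) m'"
        "stores 22 (2 ^ card C) (\<lambda>y. int (code C (C - nbhd E (decode C y)))) m'"
      using m(5) stores_agree[OF _ a] by (simp_all add: tables_def)
    have r: "?r < 2 ^ card C" by (rule code_less[OF finite_C]) auto
    have "decode C ?r = C - nbhd E ?D" using finite_C by (intro decode_code) auto
    then have v: "m' (addr 20 (int x)) = int (best E w ?D)" "m' (addr 21 (int x)) = int (card ?D)"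
      "m' (addr 22 (int x)) = int ?r" "m' (addr 20 (int ?r)) = int (best E w (C - nbhd E ?D))"
      "m' (addr 8 0) = int w" "m' 0 = int n"
      using storesD[OF tab(1) x] storesD[OF tab(1) r] storesD[OF tab(2) x] storesD[OF tab(3) x]
        agree_addr[OF a] m(3) input_n[OF m(1) a] by simp_all
    \<comment> \<open>As \<open>best\<close> never exceeds the cardinality, the first inequality
      forces equality.\<close>
    have cond: "0 < int (best E w ?D) - int (card ?D) + 1 \<and>
        0 < int (best E w (C - nbhd E ?D)) + int (card ?D) + int w - int n + 1 \<longleftrightarrow> good w x"
      using best_le_card[OF finite_decode, of E w x] unfolding good_def by auto
    have ex: "(\<exists>y<Suc x. good w y) \<longleftrightarrow> good w x \<or> (\<exists>y<x. good w y)"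
      by (auto simp: less_Suc_eq)
    have "wp B check_step (?I (Suc x)) m'"
      unfolding check_step_def ex cond[symmetric] using I B_bounds by (auto simp: x' v)
    then show "run B check_step m' (prog_size check_step) (?I (Suc x))" by (rule run_wp)
  next
    show "int (2 ^ card C) \<le> B" using power_le_B[of "card C"] card_C by simp
  qed (use m in \<open>auto simp: check_step_def\<close>)
  then show ?thesis
    unfolding feasible_iff_good by (rule run_weaken) (auto simp: check_step_def insert_commute)
qed

text \<open>The candidates \<open>0, ..., W\<close> take \<open>W + 1\<close> rounds, and each round
  processes \<open>2 ^ card C\<close> subsets in quadratic time.\<close>

lemma run_width_phase:
  defines "W \<equiv> LEAST w. feasible {..<n} E C w"
  assumes m: "input m" "stores_set 18 n C m" "m (addr 7 0) = 2 ^ card C" "m (addr 8 0) = 0" "m (addr 9 0) = 0"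
  shows "run B width_phase m (444 * 2 ^ card C * (n + 1) ^ 3) (\<lambda>m'. m' (addr 8 0) = int W + 1)"
proof -
  have W: "feasible {..<n} E C W" unfolding W_def
    by (rule LeastI[of _ "card {..<n}"]) (rule feasible_card)
  have Wn: "W \<le> n" unfolding W_def using feasible_card[of "{..<n}" E C] by (intro Least_le) simp
  have notW: "\<not> feasible {..<n} E C w" if "w < W" for w
    using that not_less_Least unfolding W_def by blast
  let ?A = "{5, 6, 8, 9, 10, 11, 12, 13, 14, 15, 16, 17, 19, 20, 21, 22}"
  let ?A1 = "{5, 6, 10, 11, 12, 13, 14, 15, 16, 17, 19, 20, 21, 22}"
  \<comment> \<open>After \<open>k\<close> rounds the flag refers to the candidate
    \<open>k - 1\<close>.\<close>
  let ?I = "\<lambda>k m'. m' (addr 8 0) = int k \<and> m' (addr 9 0) = of_bool (0 < k \<and> feasible {..<n} E C (k - 1))"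
  let ?s = "(2 ^ card C + 1) * (60 * (n + 1)\<^sup>2 + 3) + ((2 ^ card C + 1) * 10 + 1)"
  let ?P = "For 10 (Var 7) table_step;; For 10 (Var 7) check_step;; Set_var 8 (Var 8 \<oplus> Const 1)"
  have "run B width_phase m ((Suc W + 1) * (?s + 1)) (\<lambda>m'. ?I (Suc W) m' \<and> agree ?A m m')"
    unfolding width_phase_def
  proof (rule run_While[where I = ?I])
    show "?I 0 m" using m by simp
    show "writes ?A ?P"
      by (simp add: check_step_def table_step_def decode_loop_def decode_step_def nbhd_loop_def nbhd_step_def)
  next
    fix k m0 assume k: "k < Suc W" and I: "?I k m0" and a: "agree ?A m m0"
    have kB: "int k + 1 \<le> B" using k Wn B_bounds by linarith
    have z: "m0 (addr 9 0) = 0" using I k notW[of "k - 1"] by (cases k) auto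
    have in0: "input m0" using input_agree[OF m(1) a] .
    have m0: "stores_set 18 n C m0" "m0 (addr 7 0) = 2 ^ card C" "m0 (addr 8 0) = int k"
      using stores_set_agree[OF m(2) a] agree_addr[OF a] m I by simp_all
    have "run B ?P m0 ?s (?I (Suc k))"
    proof (rule run_Seq[OF run_table_loop[OF in0 m0]], rule run_Seq)
      fix m1 assume m1: "tables k (2 ^ card C) m1 \<and> agree ?A1 m0 m1"
      then have a1: "agree ?A1 m0 m1" by blast
      show "run B (For 10 (Var 7) check_step) m1 ((2 ^ card C + 1) * 10)
          (\<lambda>m'. m' (addr 9 0) = of_bool (feasible {..<n} E C k) \<and> agree {9, 10} m1 m')"
        using m1 m0 z agree_addr[OF a1] by (intro run_check_loop input_agree[OF in0 a1]) auto
      fix m2 assume m2: "m2 (addr 9 0) = of_bool (feasible {..<n} E C k) \<and> agree {9, 10} m1 m2"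
      then have a2: "agree {9, 10} m1 m2" by blast
      have "m2 (addr 8 0) = int k" using agree_addr[OF a1] agree_addr[OF a2] m0(3) by simp
      then have "wp B (Set_var 8 (Var 8 \<oplus> Const 1)) (?I (Suc k)) m2" using m2 kB by simp
      from run_wp[OF this] show "run B (Set_var 8 (Var 8 \<oplus> Const 1)) m2 1 (?I (Suc k))" by simp
    qed
    then show "0 < val (Const 1 \<ominus> Var 9) m0 \<and> run B ?P m0 ?s (?I (Suc k))" using z by simp
  next
    fix m' assume "?I (Suc W) m'"
    then show "\<not> 0 < val (Const 1 \<ominus> Var 9) m'" using W by simp
  qed
  then show ?thesis
  proof (rule run_weaken)
    have one: "1 \<le> (2::nat) ^ card C" by simp
    have "?s + 1 = (2 ^ card C + 1) * (60 * (n + 1)\<^sup>2 + 13) + 2" by (simp add: algebra_simps)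
    also have "\<dots> \<le> (2 * 2 ^ card C) * (73 * (n + 1)\<^sup>2) + 2 * (2 ^ card C * (n + 1)\<^sup>2)"
      using one by (intro add_mono mult_mono) (auto simp: Suc_le_eq)
    also have "\<dots> = 148 * 2 ^ card C * (n + 1)\<^sup>2" by simp
    finally have "(Suc W + 1) * (?s + 1) \<le> (3 * (n + 1)) * (148 * 2 ^ card C * (n + 1)\<^sup>2)"
      using Wn by (intro mult_mono) auto
    also have "\<dots> = 444 * 2 ^ card C * (n + 1) ^ 3"
      unfolding power3_eq_cube power2_eq_square by (simp only: ac_simps)
    finally show "(Suc W + 1) * (?s + 1) \<le> 444 * 2 ^ card C * (n + 1) ^ 3" .
  qed auto
qed

end

section \<open>The complete program and its logarithmic running time\<close>

definition pathwidth_prog :: prog where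
  "pathwidth_prog = cover_phase;; count_phase;; width_phase"

text \<open>The offset 2 combines the difference between bag size and width with the last increment
  of the counter. The constant is \<open>516 = 64 + 8 + 444\<close>, one summand per phase.\<close>

lemma (in graph_memory) run_pathwidth_prog:
  defines "k \<equiv> vertex_cover_number {..<n} (complement_edges {..<n} E)"
  shows "run B pathwidth_prog (graph_input n E) (516 * 2 ^ k * (n + 1) ^ 3)
    (\<lambda>m'. m' (addr 8 0) = pathwidth {..<n} E + 2)"
proof -
  define J where "J = (LEAST j. 0 < guided_rest n E j)"
  define C where "C = guided_cover n E J"
  obtain j where j: "j < 2 ^ (k + 1)" "0 < guided_rest n E j"
    using guide_exists_vertex_cover_number unfolding k_def by blast
  have "J \<le> j" unfolding J_def using j(2) by (rule Least_le)
  with j(1) have Jk: "J < 2 ^ (k + 1)" by simp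
  have ex: "0 < guided_rest n E J" unfolding J_def using j(2) by (rule LeastI)
  have kn: "k \<le> n" unfolding k_def by (rule vertex_cover_number_le)
  have "int J < 2 ^ (k + 1)" using Jk by (metis of_nat_less_iff of_nat_numeral of_nat_power)
  also have "\<dots> \<le> B" using kn by (intro power_le_B) simp
  finally have JB: "int J \<le> B" by simp
  have Cn: "C \<subseteq> {..<n}" unfolding C_def guided_cover_def by (rule guided_subset) simp
  \<comment> \<open>The guide \<open>J\<close> is not exhausted, so
    \<open>2 ^ card C \<le> J < 2 ^ (k + 1)\<close>: the cover found has at most \<open>k\<close>
    vertices.\<close>
  have "0 < J div 2 ^ card C"
    using ex fst_guided[of "n * n" n E J] by (simp add: guided_rest_def C_def guided_cover_def)
  then have "2 ^ card C \<le> J" by (simp add: div_greater_zero_iff)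
  then have "(2::nat) ^ card C < 2 ^ (k + 1)" using Jk by simp
  then have ck: "card C \<le> k" by (subst (asm) power_strict_increasing_iff) auto
  interpret graph_cover n E B C by unfold_locales (rule Cn)
  have clique: "{u, v} \<in> E" if "u \<in> {..<n} - C" "v \<in> {..<n} - C" "u \<noteq> v" for u v
  proof (cases "u < v")
    case True
    then show ?thesis using guided_cover[of u v n E J] that unfolding C_def by blast
  next
    case False
    then have "{v, u} \<in> E" using guided_cover[of v u n E J] that unfolding C_def by auto
    then show ?thesis by (simp add: insert_commute)
  qed
  have pw: "pathwidth {..<n} E = int (LEAST w. feasible {..<n} E C w) - 1"
    by (rule pathwidth_eq_Least_feasible[OF G Cn clique])
  let ?m = "graph_input n E"
  \<comment> \<open>The working memory has negative addresses, where the input memory is 0.\<close>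
  have zero: "?m (addr (numeral l) 0) = 0" for l
  proof -
    have "addr (numeral l) 0 < 0" by simp
    then show ?thesis unfolding graph_input_def by (smt (verit) of_nat_0_le_iff mult_nonneg_nonneg)
  qed
  have cov: "run B cover_phase ?m ((J + 1) * (32 * (n + 1)\<^sup>2))
    (\<lambda>m'. stores_set 18 n C m' \<and> agree {2, 3, 4, 5, 6, 18} ?m m')"
    using run_cover_phase[OF input_graph_input zero zero] JB unfolding C_def J_def by blast
  have "run B pathwidth_prog ?m ((J + 1) * (32 * (n + 1)\<^sup>2) + ((n + 1) * 8 + 444 * 2 ^ card C * (n + 1) ^ 3))
    (\<lambda>m'. m' (addr 8 0) = pathwidth {..<n} E + 2)"
    unfolding pathwidth_prog_def
  proof (rule run_Seq[OF cov], rule run_Seq)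
    fix m1 assume "stores_set 18 n C m1 \<and> agree {2, 3, 4, 5, 6, 18} ?m m1"
    then have m1: "stores_set 18 n C m1" "agree {2, 3, 4, 5, 6, 18} ?m m1" by simp_all
    have in1: "input m1" using input_agree[OF input_graph_input m1(2)] .
    show "run B count_phase m1 ((n + 1) * 8) (\<lambda>m'. m' (addr 7 0) = 2 ^ card C \<and> agree {5, 7} m1 m')"
      by (rule run_count_phase[OF in1 m1(1)])
    fix m2 assume m2: "m2 (addr 7 0) = 2 ^ card C \<and> agree {5, 7} m1 m2"
    then have a2: "agree {5, 7} m1 m2" by blast
    have st2: "stores_set 18 n C m2" using stores_set_agree[OF m1(1) a2] by simp
    have "m2 (addr 8 0) = 0" "m2 (addr 9 0) = 0"
      using agree_addr[OF m1(2)] agree_addr[OF a2] zero by simp_all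
    then have "run B width_phase m2 (444 * 2 ^ card C * (n + 1) ^ 3)
        (\<lambda>m'. m' (addr 8 0) = int (LEAST w. feasible {..<n} E C w) + 1)"
      using m2 by (intro run_width_phase input_agree[OF in1 a2] st2) auto
    then show "run B width_phase m2 (444 * 2 ^ card C * (n + 1) ^ 3)
        (\<lambda>m'. m' (addr 8 0) = pathwidth {..<n} E + 2)"
      by (rule run_weaken) (rule order_refl, use pw in linarith)
  qed
  then show ?thesis
  proof (rule run_weaken)
    have one: "1 \<le> (2::nat) ^ k" by simp
    have p: "(n + 1)\<^sup>2 \<le> (n + 1) ^ 3" "n + 1 \<le> (n + 1) ^ 3"
      using power_increasing[of 2 3 "n + 1"] power_increasing[of 1 3 "n + 1"] by simp_all
    have "(J + 1) * (32 * (n + 1)\<^sup>2) \<le> 2 ^ (k + 1) * (32 * (n + 1) ^ 3)"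
      using Jk p by (intro mult_mono) auto
    also have "\<dots> = 64 * 2 ^ k * (n + 1) ^ 3" by simp
    finally have 1: "(J + 1) * (32 * (n + 1)\<^sup>2) \<le> 64 * 2 ^ k * (n + 1) ^ 3" .
    have "1 * (n + 1) \<le> 2 ^ k * (n + 1) ^ 3" using one p(2) by (rule mult_mono) auto
    then have 2: "(n + 1) * 8 \<le> 8 * 2 ^ k * (n + 1) ^ 3" by simp
    have "(2::nat) ^ card C \<le> 2 ^ k" using ck by (intro power_increasing) auto
    then have 3: "444 * 2 ^ card C * (n + 1) ^ 3 \<le> 444 * 2 ^ k * (n + 1) ^ 3" by simp
    show "(J + 1) * (32 * (n + 1)\<^sup>2) + ((n + 1) * 8 + 444 * 2 ^ card C * (n + 1) ^ 3)
      \<le> 516 * 2 ^ k * (n + 1) ^ 3"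
      using 1 2 3 by linarith
  qed auto
qed

theorem theorem8:
  shows "\<exists>(P :: prog) (T :: nat \<Rightarrow> nat \<Rightarrow> nat).
    (\<lambda>n k. real (T n k)) \<in> O_star (\<lambda>n k. 2 ^ k) \<and>
    (\<forall>(n :: nat) (E :: nat set set). simple_graph {..<n} E \<longrightarrow>
      (\<exists>t m. exec P (graph_input n E) t m \<and>
        m 0 = pathwidth {..<n} E \<and>
        t \<le> T n (vertex_cover_number {..<n} (complement_edges {..<n} E))))"
proof -
  \<comment> \<open>This write to cell 0 overwrites the input. Its address is not negative, so its
    cost is computed directly from \<open>exec_Assign\<close>.\<close>
  let ?out = "Assign (Const 0) (Var 8 \<ominus> Const 2)"
  \<comment> \<open>Here \<open>1548 = 3 * 516\<close>; both factors 3 come from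
    \<open>2 * n + 3 \<le> 3 * (n + 1)\<close>. This binary length raises the cubic step count to
    the fourth power in \<open>T\<close>.\<close>
  define K where "K = 1548 * prog_weight pathwidth_prog + 3 * prog_weight ?out"
  define T where "T = (\<lambda>n k. K * (2 ^ k * (n + 1) ^ 4))"
  have "(\<lambda>n k. real (T n k)) \<in> O_star (\<lambda>n k. 2 ^ k)"
  proof -
    have "norm (real (T n k)) \<le> real (K * 16) * norm (2 ^ k * real n ^ 4)" if "1 \<le> n" for n k
    proof -
      \<comment> \<open>For \<open>1 \<le> n\<close> one has \<open>n + 1 \<le> 2 * n\<close>,
        whence the factor 16, uniformly in \<open>k\<close>.\<close>
      have "(n + 1) ^ 4 \<le> (2 * n) ^ 4" using that by (intro power_mono) auto
      also have "\<dots> = 16 * n ^ 4" by (simp add: power_mult_distrib)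
      finally have "T n k \<le> K * 16 * (2 ^ k * n ^ 4)"
        by (simp add: T_def mult.assoc mult.left_commute)
      then have "real (T n k) \<le> real (K * 16 * (2 ^ k * n ^ 4))" by (rule of_nat_mono)
      then show ?thesis by simp
    qed
    then have "eventually (\<lambda>x. norm (case x of (n, k) \<Rightarrow> real (T n k))
        \<le> real (K * 16) * norm (case x of (n, k) \<Rightarrow> 2 ^ k * real n ^ 4)) (sequentially \<times>\<^sub>F top)"
      unfolding eventually_prod_filter
      by (intro exI[of _ "\<lambda>n. 1 \<le> n"] exI[of _ "\<lambda>_. True"]) (auto simp: eventually_ge_at_top)
    then have "(\<lambda>(n, k). real (T n k)) \<in> O[sequentially \<times>\<^sub>F top](\<lambda>(n, k). 2 ^ k * real n ^ 4)"
      by (rule bigoI)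
    then show ?thesis unfolding O_star_def by blast
  qed
  moreover have "\<exists>t m. exec (pathwidth_prog;; ?out) (graph_input n E) t m \<and> m 0 = pathwidth {..<n} E \<and>
      t \<le> T n (vertex_cover_number {..<n} (complement_edges {..<n} E))"
    if G: "simple_graph {..<n} E" for n E
  proof -
    let ?b = "2 * n + 3" and ?k = "vertex_cover_number {..<n} (complement_edges {..<n} E)"
    let ?m = "graph_input n E"
    interpret graph_memory n E "2 ^ ?b" by unfold_locales (simp_all add: G)
    obtain s m1 where s: "bexec (2 ^ ?b) pathwidth_prog ?m s m1" "s \<le> 516 * 2 ^ ?k * (n + 1) ^ 3"
      and m1: "m1 (addr 8 0) = pathwidth {..<n} E + 2"
      using run_pathwidth_prog unfolding run_def by blast
    have "\<bar>?m a\<bar> \<le> 2 ^ ?b" for a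
      using B_bounds by (auto simp: graph_input_def)
    then obtain t where t: "exec pathwidth_prog ?m t m1" "t \<le> s * (prog_weight pathwidth_prog * ?b)"
      and b1: "\<And>a. \<bar>m1 a\<bar> \<le> 2 ^ ?b"
      using exec_of_bexec[OF s(1)] by auto
    let ?u = "1 + expr_cost (Const 0) m1 + expr_cost (Var 8 \<ominus> Const 2) m1"
    have "exec ?out m1 ?u (m1(0 := pathwidth {..<n} E))"
      using exec_Assign[of "Const 0" "Var 8 \<ominus> Const 2" m1] m1 by simp
    from exec_Seq[OF t(1) this]
    have e: "exec (pathwidth_prog;; ?out) ?m (t + ?u) (m1(0 := pathwidth {..<n} E))" .
    have u: "?u \<le> prog_weight ?out * ?b"
      using expr_cost_le[of m1 ?b "Const 0", OF b1] expr_cost_le[of m1 ?b "Var 8 \<ominus> Const 2", OF b1]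
      by (simp add: algebra_simps)
    let ?q = "2 ^ ?k * (n + 1) ^ 3"
    have b: "?b \<le> 3 * (n + 1)" by simp
    have q: "1 \<le> ?q" by (simp add: Suc_le_eq)
    have "t \<le> (516 * ?q) * (prog_weight pathwidth_prog * (3 * (n + 1)))"
      using t(2) s(2) b by (elim order_trans) (intro mult_mono, auto simp: mult.assoc)
    moreover have "?u \<le> prog_weight ?out * (3 * (n + 1)) * ?q"
    proof -
      have "?u \<le> prog_weight ?out * (3 * (n + 1))" using u b by (meson le_trans mult_le_mono2)
      also have "\<dots> \<le> prog_weight ?out * (3 * (n + 1)) * ?q" using q by simp
      finally show ?thesis .
    qed
    ultimately have "t + ?u \<le> (516 * ?q) * (prog_weight pathwidth_prog * (3 * (n + 1))) +
        prog_weight ?out * (3 * (n + 1)) * ?q" by (rule add_mono)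
    also have "\<dots> = K * (?q * (n + 1))" unfolding K_def by (simp only: algebra_simps)
    also have "\<dots> = T n ?k"
    proof -
      have "x ^ 4 = x ^ 3 * x" for x :: nat by (simp add: numeral_eq_Suc)
      then show ?thesis by (simp only: T_def mult.assoc)
    qed
    finally have "t + ?u \<le> T n ?k" .
    then show ?thesis using e by (intro exI[of _ "t + ?u"] exI[of _ "m1(0 := pathwidth {..<n} E)"]) simp
  qed
  ultimately show ?thesis by blast
qed

end
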